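(* Let $M^n$ be an $H$-umbilical Lagrangian immersion in $\mathbb{C}^n\cong\mathbb{E}^{2n}$. Then $$\rho \leq \|H\|^2-\rho^{\perp},$$ with equality at every point if and only if $M^n$ is totally geodesic.
   Context: A submanifold $M^n$ of $\mathbb{C}^n$ (with its standard flat Kähler structure and complex structure $J$) is Lagrangian if at every point $p$ the map $J$ induces an isomorphism between $T_pM$ and the normal space $T_p^{\perp}M$; in particular $\dim M=n$. It is called $H$-umbilical if its second fundamental form $h$ satisfies $$h(E_1,E_1)=\lambda JE_1,\quad h(E_2,E_2)=\cdots=h(E_n,E_n)=\mu JE_1,$$ $$h(E_1,E_j)=\mu JE_j,\quad h(E_j,E_k)=0\ \text{ for } j,k\in\{2,\ldots,n\},\ j\neq k,$$ for some suitable functions $\lambda,\mu$ and a suitable orthonormal local frame field $\{E_1,\ldots,E_n\}$ on $M^n$. Totally geodesic means $h=0$. Let $R$ be the Riemann-Christoffel curvature tensor of $M^n$ (with the sign convention that $\langle R(X,Y)Y,X\rangle$ is the sectional curvature for orthonormal $X,Y$) and $R^{\perp}$ the curvature tensor of the normal connection. With $\{e_1,\ldots,e_n\}$ an orthonormal basis of $T_pM$ and $\{u_1,\ldots,u_n\}$ an orthonormal basis of $T_p^{\perp}M$, define at $p$: - the normalized scalar curvature $\rho=\frac{2}{n(n-1)}\sum_{1\le i<j\le n}\langle R(e_i,e_j)e_j,e_i\rangle$; - the normalized normal scalar curvature $\rho^{\perp}=\frac{2}{n(n-1)}\sqrt{\sum_{1\le i<j\le n}\sum_{1\le\alpha<\beta\le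 n}\langle R^{\perp}(e_i,e_j)u_{\alpha},u_{\beta}\rangle^2}$; - the mean curvature vector $H=\frac1n\sum_{i=1}^n h(e_i,e_i)$.
   Formalization: That equality at every point forces M to be totally geodesic is stated only for n ≥ 3, since it fails for n = 2 (Whitney sphere without poles, λ = 3μ); the inequality and the converse are stated for all n ≥ 2, and n = 1, where ρ is undefined, is excluded. *)

theory Defs
  imports "HOL-Analysis.Analysis"
begin

section \<open>Smooth maps between Euclidean spaces\<close>

primrec Ck_on :: "nat \<Rightarrow> ('a::real_normed_vector) set \<Rightarrow> ('a \<Rightarrow> 'b::real_normed_vector) \<Rightarrow> bool" where
  "Ck_on 0 S F \<longleftrightarrow> continuous_on S F"
| "Ck_on (Suc k) S F \<longleftrightarrow>
     (\<forall>x\<in>S. F differentiable (at x)) \<and> (\<forall>v. Ck_on k S (\<lambda>x. frechet_derivative F (at x) v))"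

text \<open>Meant for open \<open>S\<close> in finite dimension.\<close>

definition smooth_on :: "('a::real_normed_vector) set \<Rightarrow> ('a \<Rightarrow> 'b::real_normed_vector) \<Rightarrow> bool" where
  "smooth_on S F \<longleftrightarrow> (\<forall>k. Ck_on k S F)"


section \<open>Immersed submanifolds in a local parametrization\<close>

text \<open>
  Throughout this section \<open>F\<close> is a parametrization defined near a point \<open>x\<close> of the coordinate
  space.  A coordinate vector \<open>v\<close> is identified with the constant vector field \<open>v\<close>; the bracket
  of two such fields vanishes, so the term with \<open>[X, Y]\<close> drops out of both curvature operators.
\<close>

abbreviation dird :: "('a::real_normed_vector \<Rightarrow> 'b::real_normed_vector) \<Rightarrow> 'a \<Rightarrow> 'a \<Rightarrow> 'b" where
  "dird F x v \<equiv> frechet_derivative F (at x) v"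

definition loc_tangent :: "('a::euclidean_space \<Rightarrow> 'b::euclidean_space) \<Rightarrow> 'a \<Rightarrow> 'b set" where
  "loc_tangent F x = range (dird F x)"

definition normal_part :: "('b::euclidean_space) set \<Rightarrow> 'b \<Rightarrow> 'b" where
  "normal_part T a = (THE w. w \<in> orthogonal_comp T \<and> a - w \<in> T)"

definition loc_metric :: "('a::euclidean_space \<Rightarrow> 'b::euclidean_space) \<Rightarrow> 'a \<Rightarrow> 'a \<Rightarrow> 'a \<Rightarrow> real" where
  "loc_metric F x v w = dird F x v \<bullet> dird F x w"

text \<open>
  Christoffel symbols of the induced metric: \<open>christoffel F x v w\<close> is the covariant derivative
  at \<open>x\<close> of the constant field \<open>w\<close> in the direction \<open>v\<close>, given by the Koszul formula.
\<close>

definition christoffel :: "('a::euclidean_space \<Rightarrow> 'b::euclidean_space) \<Rightarrow> 'a \<Rightarrow> 'a \<Rightarrow> 'a \<Rightarrow> 'a" where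
  "christoffel F x v w = (THE z. \<forall>u. loc_metric F x z u =
     (dird (\<lambda>y. loc_metric F y w u) x v
      + dird (\<lambda>y. loc_metric F y v u) x w
      - dird (\<lambda>y. loc_metric F y v w) x u) / 2)"

definition loc_nabla ::
  "('a::euclidean_space \<Rightarrow> 'b::euclidean_space) \<Rightarrow> 'a \<Rightarrow> ('a \<Rightarrow> 'a) \<Rightarrow> 'a \<Rightarrow> 'a" where
  "loc_nabla F v Z x = dird Z x v + christoffel F x v (Z x)"

definition loc_curvature ::
  "('a::euclidean_space \<Rightarrow> 'b::euclidean_space) \<Rightarrow> 'a \<Rightarrow> 'a \<Rightarrow> ('a \<Rightarrow> 'a) \<Rightarrow> 'a \<Rightarrow> 'a" where
  "loc_curvature F v w Z x =
     loc_nabla F v (loc_nabla F w Z) x - loc_nabla F w (loc_nabla F v Z) x"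

definition loc_second_ff ::
  "('a::euclidean_space \<Rightarrow> 'b::euclidean_space) \<Rightarrow> 'a \<Rightarrow> 'a \<Rightarrow> 'a \<Rightarrow> 'b" where
  "loc_second_ff F x v w = normal_part (loc_tangent F x) (dird (\<lambda>y. dird F y w) x v)"

definition loc_nabla_perp ::
  "('a::euclidean_space \<Rightarrow> 'b::euclidean_space) \<Rightarrow> 'a \<Rightarrow> ('a \<Rightarrow> 'b) \<Rightarrow> 'a \<Rightarrow> 'b" where
  "loc_nabla_perp F v \<xi> x = normal_part (loc_tangent F x) (dird \<xi> x v)"

definition loc_curvature_perp ::
  "('a::euclidean_space \<Rightarrow> 'b::euclidean_space) \<Rightarrow> 'a \<Rightarrow> 'a \<Rightarrow> ('a \<Rightarrow> 'b) \<Rightarrow> 'a \<Rightarrow> 'b" where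
  "loc_curvature_perp F v w \<xi> x =
     loc_nabla_perp F v (loc_nabla_perp F w \<xi>) x - loc_nabla_perp F w (loc_nabla_perp F v \<xi>) x"


section \<open>Smooth manifolds\<close>

type_synonym ('m, 'n) chart = "'m set \<times> ('m \<Rightarrow> real^'n)"

definition local_rep :: "('m, 'n::finite) chart \<Rightarrow> ('m \<Rightarrow> 'b) \<Rightarrow> real^'n \<Rightarrow> 'b" where
  "local_rep c g = (\<lambda>x. g (inv_into (fst c) (snd c) x))"

definition smooth_manifold :: "'m topology \<Rightarrow> ('m, 'n::finite) chart set \<Rightarrow> bool" where
  "smooth_manifold M \<A> \<longleftrightarrow>
     Hausdorff_space M \<and> second_countable M \<and> (\<Union>c\<in>\<A>. fst c) = topspace M \<and>
     (\<forall>(U, \<phi>)\<in>\<A>. openin M U \<and> open (\<phi> ` U) \<and>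
        homeomorphic_map (subtopology M U) (top_of_set (\<phi> ` U)) \<phi>) \<and>
     (\<forall>(U, \<phi>)\<in>\<A>. \<forall>(V, \<psi>)\<in>\<A>. smooth_on (\<phi> ` (U \<inter> V)) (local_rep (U, \<phi>) \<psi>))"

definition smooth_map_on ::
  "('m, 'n::finite) chart set \<Rightarrow> 'm set \<Rightarrow> ('m \<Rightarrow> 'b::real_normed_vector) \<Rightarrow> bool" where
  "smooth_map_on \<A> W g \<longleftrightarrow> (\<forall>(U, \<phi>)\<in>\<A>. smooth_on (\<phi> ` (U \<inter> W)) (local_rep (U, \<phi>) g))"

definition immersion ::
  "'m topology \<Rightarrow> ('m, 'n::finite) chart set \<Rightarrow> ('m \<Rightarrow> 'b::euclidean_space) \<Rightarrow> bool" where
  "immersion M \<A> f \<longleftrightarrow> smooth_map_on \<A> (topspace M) f \<and>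
     (\<forall>(U, \<phi>)\<in>\<A>. \<forall>p\<in>U. inj (dird (local_rep (U, \<phi>) f) (\<phi> p)))"


section \<open>Geometry of an immersion at a point\<close>

text \<open>
  Pointwise notions are computed in an arbitrarily selected chart around the point, on which they
  do not depend.  Tangent vectors at \<open>p\<close> are represented by their images under the differential of
  the immersion \<open>f\<close>, i.e. as vectors of the ambient space; \<open>coords\<close> converts back to coordinates.
\<close>

definition chart_at :: "('m, 'n::finite) chart set \<Rightarrow> 'm \<Rightarrow> ('m, 'n) chart" where
  "chart_at \<A> p = (SOME c. c \<in> \<A> \<and> p \<in> fst c)"

definition param_at :: "('m, 'n::finite) chart set \<Rightarrow> ('m \<Rightarrow> 'b) \<Rightarrow> 'm \<Rightarrow> real^'n \<Rightarrow> 'b" where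
  "param_at \<A> f p = local_rep (chart_at \<A> p) f"

definition pos_at :: "('m, 'n::finite) chart set \<Rightarrow> 'm \<Rightarrow> real^'n" where
  "pos_at \<A> p = snd (chart_at \<A> p) p"

definition tangent_space ::
  "('m, 'n::finite) chart set \<Rightarrow> ('m \<Rightarrow> 'b::euclidean_space) \<Rightarrow> 'm \<Rightarrow> 'b set" where
  "tangent_space \<A> f p = loc_tangent (param_at \<A> f p) (pos_at \<A> p)"

definition perp_space ::
  "('m, 'n::finite) chart set \<Rightarrow> ('m \<Rightarrow> 'b::euclidean_space) \<Rightarrow> 'm \<Rightarrow> 'b set" where
  "perp_space \<A> f p = orthogonal_comp (tangent_space \<A> f p)"

definition coords ::
  "('m, 'n::finite) chart set \<Rightarrow> ('m \<Rightarrow> 'b::euclidean_space) \<Rightarrow> 'm \<Rightarrow> 'b \<Rightarrow> real^'n" where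
  "coords \<A> f p X = inv (dird (param_at \<A> f p) (pos_at \<A> p)) X"

definition second_ff ::
  "('m, 'n::finite) chart set \<Rightarrow> ('m \<Rightarrow> 'b::euclidean_space) \<Rightarrow> 'm \<Rightarrow> 'b \<Rightarrow> 'b \<Rightarrow> 'b" where
  "second_ff \<A> f p X Y =
     loc_second_ff (param_at \<A> f p) (pos_at \<A> p) (coords \<A> f p X) (coords \<A> f p Y)"

text \<open>The curvature operators are tensorial; \<open>Z\<close> is extended as a constant coordinate field.\<close>

definition curvature ::
  "('m, 'n::finite) chart set \<Rightarrow> ('m \<Rightarrow> 'b::euclidean_space) \<Rightarrow> 'm \<Rightarrow> 'b \<Rightarrow> 'b \<Rightarrow> 'b \<Rightarrow> 'b" where
  "curvature \<A> f p X Y Z =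
     dird (param_at \<A> f p) (pos_at \<A> p)
       (loc_curvature (param_at \<A> f p) (coords \<A> f p X) (coords \<A> f p Y)
          (\<lambda>_. coords \<A> f p Z) (pos_at \<A> p))"

text \<open>A normal vector \<open>u\<close> at \<open>p\<close> is extended by projecting it to the nearby normal spaces.\<close>

definition curvature_perp ::
  "('m, 'n::finite) chart set \<Rightarrow> ('m \<Rightarrow> 'b::euclidean_space) \<Rightarrow> 'm \<Rightarrow> 'b \<Rightarrow> 'b \<Rightarrow> 'b \<Rightarrow> 'b" where
  "curvature_perp \<A> f p X Y u =
     loc_curvature_perp (param_at \<A> f p) (coords \<A> f p X) (coords \<A> f p Y)
       (\<lambda>y. normal_part (loc_tangent (param_at \<A> f p) y) u) (pos_at \<A> p)"

definition totally_geodesic ::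
  "'m topology \<Rightarrow> ('m, 'n::finite) chart set \<Rightarrow> ('m \<Rightarrow> 'b::euclidean_space) \<Rightarrow> bool" where
  "totally_geodesic M \<A> f \<longleftrightarrow>
     (\<forall>p\<in>topspace M. \<forall>X\<in>tangent_space \<A> f p. \<forall>Y\<in>tangent_space \<A> f p. second_ff \<A> f p X Y = 0)"

definition orthonormal_basis :: "nat \<Rightarrow> ('b::euclidean_space) set \<Rightarrow> (nat \<Rightarrow> 'b) \<Rightarrow> bool" where
  "orthonormal_basis m V e \<longleftrightarrow>
     (\<forall>i\<in>{1..m}. \<forall>j\<in>{1..m}. e i \<bullet> e j = (if i = j then 1 else 0)) \<and> span (e ` {1..m}) = V"

text \<open>Below, \<open>e\<close> and \<open>u\<close> are orthonormal bases of the tangent and the normal space at \<open>p\<close>.\<close>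

definition norm_scalar_curv ::
  "('m, 'n::finite) chart set \<Rightarrow> ('m \<Rightarrow> complex^'n) \<Rightarrow> 'm \<Rightarrow> (nat \<Rightarrow> complex^'n) \<Rightarrow> real" where
  "norm_scalar_curv \<A> f p e =
     2 / (real CARD('n) * (real CARD('n) - 1)) *
     (\<Sum>i=1..CARD('n). \<Sum>j\<in>{i<..CARD('n)}. curvature \<A> f p (e i) (e j) (e j) \<bullet> e i)"

definition norm_normal_scalar_curv ::
  "('m, 'n::finite) chart set \<Rightarrow> ('m \<Rightarrow> complex^'n) \<Rightarrow> 'm \<Rightarrow>
     (nat \<Rightarrow> complex^'n) \<Rightarrow> (nat \<Rightarrow> complex^'n) \<Rightarrow> real" where
  "norm_normal_scalar_curv \<A> f p e u =
     2 / (real CARD('n) * (real CARD('n) - 1)) *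
     sqrt (\<Sum>i=1..CARD('n). \<Sum>j\<in>{i<..CARD('n)}. \<Sum>\<alpha>=1..CARD('n). \<Sum>\<beta>\<in>{\<alpha><..CARD('n)}.
       (curvature_perp \<A> f p (e i) (e j) (u \<alpha>) \<bullet> u \<beta>)\<^sup>2)"

definition mean_curvature ::
  "('m, 'n::finite) chart set \<Rightarrow> ('m \<Rightarrow> complex^'n) \<Rightarrow> 'm \<Rightarrow> (nat \<Rightarrow> complex^'n) \<Rightarrow> complex^'n" where
  "mean_curvature \<A> f p e =
     (1 / real CARD('n)) *\<^sub>R (\<Sum>i=1..CARD('n). second_ff \<A> f p (e i) (e i))"


section \<open>\<open>H\<close>-umbilical Lagrangian immersions\<close>

definition cplx_J :: "complex^'n \<Rightarrow> complex^'n::finite" where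
  "cplx_J v = (\<chi> k. \<i> * v $ k)"

definition lagrangian ::
  "'m topology \<Rightarrow> ('m, 'n::finite) chart set \<Rightarrow> ('m \<Rightarrow> complex^'n) \<Rightarrow> bool" where
  "lagrangian M \<A> f \<longleftrightarrow>
     (\<forall>p\<in>topspace M. bij_betw cplx_J (tangent_space \<A> f p) (perp_space \<A> f p))"

definition H_umbilical ::
  "'m topology \<Rightarrow> ('m, 'n::finite) chart set \<Rightarrow> ('m \<Rightarrow> complex^'n) \<Rightarrow> bool" where
  "H_umbilical M \<A> f \<longleftrightarrow>
     (\<forall>p\<in>topspace M. \<exists>W (E :: nat \<Rightarrow> 'm \<Rightarrow> complex^'n) lam mu.
        openin M W \<and> p \<in> W \<and>
        (\<forall>i\<in>{1..CARD('n)}. smooth_map_on \<A> W (E i)) \<and>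
        (\<forall>q\<in>W.
           orthonormal_basis CARD('n) (tangent_space \<A> f q) (\<lambda>i. E i q) \<and>
           second_ff \<A> f q (E 1 q) (E 1 q) = (lam q :: real) *\<^sub>R cplx_J (E 1 q) \<and>
           (\<forall>j\<in>{2..CARD('n)}. second_ff \<A> f q (E j q) (E j q) = (mu q :: real) *\<^sub>R cplx_J (E 1 q)) \<and>
           (\<forall>j\<in>{2..CARD('n)}. second_ff \<A> f q (E 1 q) (E j q) = mu q *\<^sub>R cplx_J (E j q)) \<and>
           (\<forall>j\<in>{2..CARD('n)}. \<forall>k\<in>{2..CARD('n)}. j \<noteq> k \<longrightarrow> second_ff \<A> f q (E j q) (E k q) = 0)))"

end

theory Submission
  imports Defs
begin

text \<open>
  By the Gauss and Ricci equations all three quantities are determined by the second fundamental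
  form at the point, and none of them depends on the choice of orthonormal bases, so that they may
  be computed in the frame \<open>E\<^sub>i\<close>, \<open>J E\<^sub>i\<close>.  With \<open>y = (\<lambda> - \<mu>)\<^sup>2\<close> and \<open>m = \<mu>\<^sup>2\<close> the inequality becomes
  \<open>y + 2nm \<ge> 2n \<surd>(m (y + (n - 2) m / 2) / (n - 1))\<close>, and the difference of the squares of
  both sides, multiplied by \<open>(n - 1)\<^sup>2\<close>, is
  \<open>((n - 1) y - 2nm)\<^sup>2 + 2n\<^sup>2 (n - 2) (n + 1) m\<^sup>2\<close>.  For \<open>n \<ge> 3\<close> it vanishes
  only if \<open>\<mu> = 0\<close> and \<open>\<lambda> = \<mu>\<close>.
\<close>

section \<open>Symmetry of second derivatives\<close>

text \<open>Both curvature operators are iterated covariant derivatives, and the Christoffel field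
  and the normal projection inside them are given by definite descriptions. Before the Gauss and
  Ricci equations can be derived, these must be known to vary differentiably with the point. The
  remedy is to express both through one map, the coordinates of the tangential part of an ambient
  vector. They solve a linear system with the Gram matrix of the coordinate frame, and Cramer's rule
  gives differentiability. The derivative of that map is never computed from this formula: it is
  eliminated by differentiating the defining identity, or it disappears under a projection. A second
  obstacle is that the curvatures are sums over \<open>i < j\<close>, which are not traces, in bases
  unrelated to the frame. The symmetry of the summands turns them into full double sums, in which
  bases can be exchanged slot by slot.\<close>

lemma second_difference_quotient_tendsto:
  fixes g :: "'a::real_normed_vector \<Rightarrow> real"
  assumes "open S" "x \<in> S"
    and g: "\<And>y. y \<in> S \<Longrightarrow> (g has_derivative g' y) (at y)"
    and h: "((\<lambda>y. g' y v) has_derivative h') (at x)"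
  shows "((\<lambda>t. (g (x + t *\<^sub>R v + t *\<^sub>R w) - g (x + t *\<^sub>R v) - g (x + t *\<^sub>R w) + g x) / t\<^sup>2)
           \<longlongrightarrow> h' w) (at_right 0)"
proof (rule tendstoI)
  fix \<epsilon> :: real assume "\<epsilon> > 0"
  \<comment> \<open>The summand 1 keeps \<open>K\<close> positive even when \<open>v\<close> and
    \<open>w\<close> both vanish. Two error estimates are added below, hence the factor 2 in
    \<open>\<eta>\<close>.\<close>
  define K where "K = norm v + norm w + 1"
  define \<eta> where "\<eta> = \<epsilon> / (2 * K)"
  have K: "K > 0" "norm v + norm w < K" unfolding K_def by (auto intro: add_nonneg_pos)
  then have \<eta>: "\<eta> > 0" unfolding \<eta>_def using \<open>\<epsilon> > 0\<close> by simp
  interpret h': bounded_linear h' using h by (rule has_derivative_bounded_linear)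
  obtain d1 where d1: "d1 > 0"
      "\<And>y. norm (y - x) < d1 \<Longrightarrow> norm (g' y v - g' x v - h' (y - x)) \<le> \<eta> * norm (y - x)"
    using h \<eta> unfolding has_derivative_at_alt by blast
  obtain d2 where d2: "d2 > 0" "ball x d2 \<subseteq> S"
    using \<open>open S\<close> \<open>x \<in> S\<close> open_contains_ball by blast
  define d where "d = min d1 d2 / K"
  have "d > 0" unfolding d_def using d1 d2 K by simp
  have "dist ((g (x + t *\<^sub>R v + t *\<^sub>R w) - g (x + t *\<^sub>R v) - g (x + t *\<^sub>R w) + g x) / t\<^sup>2) (h' w) < \<epsilon>"
    if t: "0 < t" "t < d" for t
  proof -
    have tK: "t * K < min d1 d2" using t K unfolding d_def by (simp add: pos_less_divide_eq)
    have bnd: "norm (s *\<^sub>R v + r *\<^sub>R w) \<le> t * (norm v + norm w)" 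
      if "0 \<le> s" "s \<le> t" "0 \<le> r" "r \<le> t" for s r
    proof -
      have "norm (s *\<^sub>R v + r *\<^sub>R w) \<le> s * norm v + r * norm w"
        using norm_triangle_ineq[of "s *\<^sub>R v" "r *\<^sub>R w"] that by simp
      also have "\<dots> \<le> t * norm v + t * norm w"
        using that by (intro add_mono mult_right_mono) auto
      finally show ?thesis by (simp add: algebra_simps)
    qed
    have small: "norm (s *\<^sub>R v + r *\<^sub>R w) < min d1 d2"
      if "0 \<le> s" "s \<le> t" "0 \<le> r" "r \<le> t" for s r
    proof -
      have "t * (norm v + norm w) \<le> t * K" using K t by (intro mult_left_mono) auto
      then show ?thesis using bnd[OF that] tK by linarith
    qed
    have inS: "x + s *\<^sub>R v + r *\<^sub>R w \<in> S" if "0 \<le> s" "s \<le> t" "0 \<le> r" "r \<le> t" for s r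
      using small[OF that] d2(2) by (auto simp: subset_iff dist_norm add.assoc norm_minus_commute)
    \<comment> \<open>The mean value theorem is applied in the direction \<open>v\<close>, to the
      increment in the direction \<open>w\<close>. It turns the second difference into an increment
      of \<open>\<lambda>y. g' y v\<close>, and the differentiability of that function at
      \<open>x\<close> gives the limit.\<close>
    define \<phi> where "\<phi> s = g (x + s *\<^sub>R v + t *\<^sub>R w) - g (x + s *\<^sub>R v)" for s
    have der: "(\<phi> has_derivative
        (\<lambda>k. k * (g' (x + s *\<^sub>R v + t *\<^sub>R w) v - g' (x + s *\<^sub>R v) v))) (at s)"
      if s: "0 \<le> s" "s \<le> t" for s
    proof -
      have A: "x + s *\<^sub>R v + t *\<^sub>R w \<in> S" using inS[OF s, of t] t by simp
      have B: "x + s *\<^sub>R v \<in> S" using inS[OF s, of 0] t by simp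
      have l: "linear (g' (x + s *\<^sub>R v + t *\<^sub>R w))" "linear (g' (x + s *\<^sub>R v))"
        using g[OF A] g[OF B] by (auto intro: has_derivative_linear)
      have "((\<lambda>s. g (x + s *\<^sub>R v + t *\<^sub>R w)) has_derivative
          (\<lambda>k. g' (x + s *\<^sub>R v + t *\<^sub>R w) (k *\<^sub>R v))) (at s)"
        by (rule has_derivative_compose[where f = "\<lambda>s. x + s *\<^sub>R v + t *\<^sub>R w" and x = s, OF _ g[OF A]]) (auto intro!: derivative_eq_intros)
      moreover have "((\<lambda>s. g (x + s *\<^sub>R v)) has_derivative (\<lambda>k. g' (x + s *\<^sub>R v) (k *\<^sub>R v))) (at s)"
        by (rule has_derivative_compose[where f = "\<lambda>s. x + s *\<^sub>R v" and x = s, OF _ g[OF B]]) (auto intro!: derivative_eq_intros)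
      ultimately show ?thesis unfolding \<phi>_def
        by (auto dest: has_derivative_diff simp: l[THEN linear_cmul] right_diff_distrib)
    qed
    obtain \<xi> where \<xi>: "\<xi> \<in> {0<..<t}"
      "\<phi> t - \<phi> 0 = (t - 0) * (g' (x + \<xi> *\<^sub>R v + t *\<^sub>R w) v - g' (x + \<xi> *\<^sub>R v) v)"
      using mvt_simple[of 0 t \<phi> "\<lambda>s k. k * (g' (x + s *\<^sub>R v + t *\<^sub>R w) v - g' (x + s *\<^sub>R v) v)"]
        der has_derivative_at_withinI t by blast
    define p where "p = \<xi> *\<^sub>R v + t *\<^sub>R w"
    define q where "q = \<xi> *\<^sub>R v"
    have eq: "h' p - h' q = t * h' w" by (simp add: p_def q_def h'.add h'.scaleR)
    have p: "norm p \<le> t * (norm v + norm w)" "norm p < d1"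
      using bnd[of \<xi> t] small[of \<xi> t] \<xi>(1) t by (auto simp: p_def)
    have q: "norm q \<le> t * (norm v + norm w)" "norm q < d1"
      using bnd[of \<xi> 0] small[of \<xi> 0] \<xi>(1) t by (auto simp: q_def)
    have P: "\<bar>g' (x + p) v - g' x v - h' p\<bar> \<le> \<eta> * (t * (norm v + norm w))"
      using d1(2)[of "x + p"] p(2) order.trans[OF _ mult_left_mono[OF p(1), of \<eta>]] \<eta> by simp
    have Q: "\<bar>g' (x + q) v - g' x v - h' q\<bar> \<le> \<eta> * (t * (norm v + norm w))"
      using d1(2)[of "x + q"] q(2) order.trans[OF _ mult_left_mono[OF q(1), of \<eta>]] \<eta> by simp
    have "\<bar>(g' (x + p) v - g' (x + q) v) - t * h' w\<bar> \<le> 2 * (\<eta> * (t * (norm v + norm w)))"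
      using P Q eq by linarith
    also have "\<dots> < 2 * (\<eta> * (t * K))" using \<eta> t K by simp
    also have "\<dots> = \<epsilon> * t" unfolding \<eta>_def using K by simp
    finally have main: "\<bar>(g' (x + p) v - g' (x + q) v) - t * h' w\<bar> < \<epsilon> * t" .
    have num: "g (x + t *\<^sub>R v + t *\<^sub>R w) - g (x + t *\<^sub>R v) - g (x + t *\<^sub>R w) + g x
        = t * (g' (x + p) v - g' (x + q) v)"
      using \<xi>(2) by (simp add: \<phi>_def p_def q_def algebra_simps)
    have "(g (x + t *\<^sub>R v + t *\<^sub>R w) - g (x + t *\<^sub>R v) - g (x + t *\<^sub>R w) + g x) / t\<^sup>2 - h' w
       = ((g' (x + p) v - g' (x + q) v) - t * h' w) / t"
      unfolding num using t by (simp add: field_simps power2_eq_square)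
    then show ?thesis
      using main t by (simp add: dist_real_def pos_divide_less_eq)
  qed
  then show "\<forall>\<^sub>F t in at_right 0. dist ((g (x + t *\<^sub>R v + t *\<^sub>R w) - g (x + t *\<^sub>R v)
      - g (x + t *\<^sub>R w) + g x) / t\<^sup>2) (h' w) < \<epsilon>"
    using \<open>d > 0\<close> by (auto simp: eventually_at_right_field)
qed

text \<open>The second difference quotient is symmetric in \<open>v\<close> and \<open>w\<close>, so
  both mixed derivatives are limits of the same function.\<close>

lemma second_derivative_symmetric_real:
  fixes g :: "'a::real_normed_vector \<Rightarrow> real"
  assumes "open S" "x \<in> S"
    and g: "\<And>y. y \<in> S \<Longrightarrow> (g has_derivative g' y) (at y)"
    and v: "((\<lambda>y. g' y v) has_derivative hv) (at x)"
    and w: "((\<lambda>y. g' y w) has_derivative hw) (at x)"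
  shows "hv w = hw v"
proof (rule tendsto_unique)
  let ?q = "\<lambda>t. (g (x + t *\<^sub>R v + t *\<^sub>R w) - g (x + t *\<^sub>R v) - g (x + t *\<^sub>R w) + g x) / t\<^sup>2"
  show "(?q \<longlongrightarrow> hv w) (at_right 0)"
    using second_difference_quotient_tendsto[OF assms(1,2) g v] .
  show "(?q \<longlongrightarrow> hw v) (at_right 0)"
    using second_difference_quotient_tendsto[OF assms(1,2) g w, of v]
    by (simp add: algebra_simps)
qed simp

section \<open>Directional derivatives of smooth maps\<close>

lemma dird_eqI: "(F has_derivative F') (at x) \<Longrightarrow> dird F x v = F' v"
  using frechet_derivative_at by metis

lemma smooth_on_differentiable: "smooth_on S F \<Longrightarrow> x \<in> S \<Longrightarrow> F differentiable (at x)"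
  unfolding smooth_on_def by (metis Ck_on.simps(2))

lemma smooth_on_has_derivative:
  "smooth_on S F \<Longrightarrow> x \<in> S \<Longrightarrow> (F has_derivative dird F x) (at x)"
  using smooth_on_differentiable frechet_derivative_works by blast

lemma smooth_on_dird: "smooth_on S F \<Longrightarrow> smooth_on S (\<lambda>x. dird F x v)"
  unfolding smooth_on_def by (metis Ck_on.simps(2))

lemma smooth_on_linear_dird: "smooth_on S F \<Longrightarrow> x \<in> S \<Longrightarrow> linear (dird F x)"
  using smooth_on_has_derivative has_derivative_linear by blast

text \<open>The scalar case applies after pairing \<open>F\<close> with an arbitrary constant
  vector, and these pairings determine a vector.\<close>

lemma dird_dird_commute:
  fixes F :: "'a::real_normed_vector \<Rightarrow> 'b::real_inner"
  assumes "open S" "smooth_on S F" "x \<in> S"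
  shows "dird (\<lambda>y. dird F y w) x v = dird (\<lambda>y. dird F y v) x w"
proof -
  have "dird (\<lambda>y. dird F y w) x v \<bullet> a = dird (\<lambda>y. dird F y v) x w \<bullet> a" for a
  proof -
    have "\<And>y. y \<in> S \<Longrightarrow> ((\<lambda>y. F y \<bullet> a) has_derivative (\<lambda>u. dird F y u \<bullet> a)) (at y)"
      by (intro has_derivative_inner_left smooth_on_has_derivative[OF assms(2)])
    moreover have "((\<lambda>y. dird F y u \<bullet> a) has_derivative (\<lambda>k. dird (\<lambda>y. dird F y u) x k \<bullet> a)) (at x)" for u
      by (intro has_derivative_inner_left smooth_on_has_derivative[OF smooth_on_dird[OF assms(2)] assms(3)])
    ultimately show ?thesis
      using second_derivative_symmetric_real[OF assms(1,3), where g = "\<lambda>y. F y \<bullet> a"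
          and g' = "\<lambda>y u. dird F y u \<bullet> a" and v = w and w = v] by blast
  qed
  then show ?thesis by (metis vector_eq_rdot)
qed

text \<open>\<open>smooth_on\<close> controls \<open>dird F y b\<close> for fixed \<open>b\<close>,
  whereas here the direction moves with \<open>y\<close>. Expanding it in \<open>Basis\<close>
  reduces the product rule to finitely many fixed directions.\<close>

lemma dird_along_field_has_derivative:
  fixes F :: "'a::euclidean_space \<Rightarrow> 'b::real_normed_vector"
  assumes "open S" "smooth_on S F" "x \<in> S" and Z: "(Z has_derivative Z') (at x)"
  shows "((\<lambda>y. dird F y (Z y)) has_derivative
           (\<lambda>v. dird F x (Z' v) + dird (\<lambda>y. dird F y (Z x)) x v)) (at x)"
proof -
  have expand: "dird F y z = (\<Sum>b\<in>Basis. (z \<bullet> b) *\<^sub>R dird F y b)" if "y \<in> S" for y z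
  proof -
    have l: "linear (dird F y)" using smooth_on_linear_dird[OF assms(2) that] .
    have "dird F y z = dird F y (\<Sum>b\<in>Basis. (z \<bullet> b) *\<^sub>R b)" by (simp add: euclidean_representation)
    then show ?thesis by (simp add: linear_sum[OF l] linear_cmul[OF l])
  qed
  have D: "((\<lambda>y. dird F y b) has_derivative dird (\<lambda>y. dird F y b) x) (at x)" for b
    by (intro smooth_on_has_derivative[OF smooth_on_dird[OF assms(2)] assms(3)])
  have *: "((\<lambda>y. \<Sum>b\<in>Basis. (c y \<bullet> b) *\<^sub>R dird F y b) has_derivative
      (\<lambda>v. (\<Sum>b\<in>Basis. (c' v \<bullet> b) *\<^sub>R dird F x b)
        + (\<Sum>b\<in>Basis. (c x \<bullet> b) *\<^sub>R dird (\<lambda>y. dird F y b) x v))) (at x)"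
    if c: "(c has_derivative c') (at x)" for c c'
  proof -
    have "((\<lambda>y. (c y \<bullet> b) *\<^sub>R dird F y b) has_derivative
      (\<lambda>v. (c x \<bullet> b) *\<^sub>R dird (\<lambda>y. dird F y b) x v + (c' v \<bullet> b) *\<^sub>R dird F x b)) (at x)" for b
      by (intro has_derivative_scaleR has_derivative_inner_left c D)
    from has_derivative_sum[OF this] show ?thesis
      by (simp add: sum.distrib add.commute)
  qed
  have tr: "((\<lambda>y. dird F y (c y)) has_derivative G) (at x)"
    if "((\<lambda>y. \<Sum>b\<in>Basis. (c y \<bullet> b) *\<^sub>R dird F y b) has_derivative G) (at x)" for c G
    using has_derivative_transform_within_open[OF that assms(1,3)] expand by simp
  have "dird (\<lambda>y. dird F y (Z x)) x v = (\<Sum>b\<in>Basis. (Z x \<bullet> b) *\<^sub>R dird (\<lambda>y. dird F y b) x v)" for v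
    using dird_eqI[OF tr[OF *[OF has_derivative_const[of "Z x"]]]] by simp
  moreover have "dird F x (Z' v) = (\<Sum>b\<in>Basis. (Z' v \<bullet> b) *\<^sub>R dird F x b)" for v
    using expand[OF assms(3)] .
  ultimately show ?thesis using tr[OF *[OF Z]] by simp
qed

section \<open>The tangential projection of an immersed patch\<close>

lemma orthogonal_comp_iff: "w \<in> orthogonal_comp T \<longleftrightarrow> (\<forall>t\<in>T. w \<bullet> t = 0)"
  by (auto simp: orthogonal_comp_def orthogonal_def inner_commute)

lemma normal_part_eqI:
  assumes "subspace T" "w \<in> orthogonal_comp T" "a - w \<in> T"
  shows "normal_part T a = w"
  unfolding normal_part_def
proof (rule the_equality)
  fix w' assume w': "w' \<in> orthogonal_comp T \<and> a - w' \<in> T"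
  have "w' - w = (a - w) - (a - w')" by simp
  then have "w' - w \<in> T" using subspace_diff[OF assms(1,3)] w' by metis
  moreover have "w' - w \<in> orthogonal_comp T"
    using w' assms(2) by (simp add: subspace_diff subspace_orthogonal_comp)
  ultimately have "(w' - w) \<bullet> (w' - w) = 0" using orthogonal_comp_iff by blast
  then show "w' = w" by simp
qed (use assms in auto)

section \<open>Differentiable dependence of solutions of linear systems\<close>

lemma differentiable_det:
  fixes A :: "'a::real_normed_vector \<Rightarrow> real^'n^'n"
  assumes "\<And>i j. (\<lambda>y. A y $ i $ j) differentiable (at x)"
  shows "(\<lambda>y. det (A y)) differentiable (at x)"
proof -
  have prod: "(\<lambda>y. \<Prod>i\<in>I. A y $ i $ p i) differentiable (at x)" for p :: "'n \<Rightarrow> 'n" and I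
    by (rule differentiableI, rule has_derivative_prod)
       (use assms in \<open>simp add: frechet_derivative_works\<close>)
  show ?thesis unfolding det_def
    by (intro differentiable_sum ballI differentiable_mult differentiable_const prod)
       (simp add: finite_permutations)
qed

text \<open>By Cramer's rule each component of the solution is a quotient of two determinants, which
  are polynomials in differentiable entries.\<close>

lemma differentiable_linear_solve:
  fixes A :: "'a::real_normed_vector \<Rightarrow> real^'n^'n" and b c :: "'a \<Rightarrow> real^'n"
  assumes "open S" "x \<in> S"
    and A: "\<And>i j. (\<lambda>y. A y $ i $ j) differentiable (at x)"
    and b: "\<And>i. (\<lambda>y. b y $ i) differentiable (at x)"
    and det: "\<And>y. y \<in> S \<Longrightarrow> det (A y) \<noteq> 0"
    and c: "\<And>y. y \<in> S \<Longrightarrow> A y *v c y = b y"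
  shows "c differentiable (at x)"
proof -
  let ?N = "\<lambda>k y. det (\<chi> i j. if j = k then b y $ i else A y $ i $ j)"
  have eq: "c y = (\<chi> k. ?N k y / det (A y))" if "y \<in> S" for y
    using c[OF that] cramer[OF det[OF that]] by blast
  have "(\<lambda>y. ?N k y) differentiable (at x)" for k
    by (rule differentiable_det, case_tac "j = k") (simp_all add: A b)
  then have q: "(\<lambda>y. ?N k y / det (A y)) differentiable (at x)" for k
    using differentiable_det[of A x, OF A] det[OF \<open>x \<in> S\<close>] by (intro differentiable_divide)
  have "(\<lambda>y. (\<chi> k. ?N k y / det (A y))) differentiable (at x)"
  proof -
    have "(\<lambda>y. \<Sum>k\<in>UNIV. (?N k y / det (A y)) *\<^sub>R axis k (1::real)) differentiable (at x)"
      by (intro differentiable_sum ballI differentiable_scaleR q differentiable_const finite)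
    moreover have "(\<Sum>k\<in>UNIV. (?N k y / det (A y)) *\<^sub>R axis k (1::real)) = (\<chi> k. ?N k y / det (A y))" for y
      by (simp add: vec_eq_iff axis_def if_distrib cong: if_cong)
    ultimately show ?thesis by simp
  qed
  then obtain D where "((\<lambda>y. (\<chi> k. ?N k y / det (A y))) has_derivative D) (at x)"
    unfolding differentiable_def by blast
  from has_derivative_transform_within_open[OF this assms(1,2) eq[symmetric]]
  show ?thesis by (rule differentiableI)
qed

text \<open>\<open>S\<close> is meant to be the image of a chart and \<open>F\<close> the immersion
  read in it. Injectivity is demanded on all of \<open>S\<close> because the projections to nearby
  tangent spaces will be differentiated.\<close>

locale immersed_patch =
  fixes S :: "(real^'n::finite) set" and F :: "real^'n \<Rightarrow> 'b::euclidean_space"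
  assumes open_S: "open S" and smooth: "smooth_on S F"
    and inj_dird: "y \<in> S \<Longrightarrow> inj (dird F y)"
begin

text \<open>This is the plain second derivative in the ambient space, not a covariant Hessian: its
  tangential part is the Christoffel term, its normal part the second fundamental form.\<close>

definition hess :: "real^'n \<Rightarrow> real^'n \<Rightarrow> real^'n \<Rightarrow> 'b"
  where "hess y v w = dird (\<lambda>z. dird F z w) y v"

text \<open>The coordinates of the tangential part of an ambient vector.\<close>

definition tang :: "real^'n \<Rightarrow> 'b \<Rightarrow> real^'n"
  where "tang y a = (THE c. \<forall>u. dird F y c \<bullet> dird F y u = a \<bullet> dird F y u)"

context
  fixes y assumes y: "y \<in> S"
begin

lemma linear_dird: "linear (dird F y)"
  using smooth_on_linear_dird[OF smooth y] .

lemma subspace_tangent: "subspace (loc_tangent F y)"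
  unfolding loc_tangent_def using linear_subspace_image[OF linear_dird] by auto

lemma dird_has_derivative: "((\<lambda>z. dird F z w) has_derivative (\<lambda>v. hess y v w)) (at y)"
  unfolding hess_def using smooth_on_has_derivative[OF smooth_on_dird[OF smooth] y] .

lemma hess_sym: "hess y v w = hess y w v"
  unfolding hess_def using dird_dird_commute[OF open_S smooth y] .

lemma linear_hess_left: "linear (\<lambda>v. hess y v w)"
  using dird_has_derivative by (rule has_derivative_linear)

lemma linear_hess_right: "linear (hess y v)"
proof -
  have "hess y v = (\<lambda>w. hess y w v)" by (simp add: fun_eq_iff hess_sym[of v])
  then show ?thesis using linear_hess_left by simp
qed

lemma dird_inner_eqD: "(\<And>u. dird F y c \<bullet> dird F y u = dird F y c' \<bullet> dird F y u) \<Longrightarrow> c = c'"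
proof -
  assume "\<And>u. dird F y c \<bullet> dird F y u = dird F y c' \<bullet> dird F y u"
  then have "(dird F y c - dird F y c') \<bullet> dird F y (c - c') = 0"
    by (simp add: inner_diff_left)
  then have "dird F y c = dird F y c'" by (simp add: linear_diff[OF linear_dird])
  then show ?thesis using inj_dird[OF y] by (auto dest: injD)
qed

lemma tang_eqI: "(\<And>u. dird F y c \<bullet> dird F y u = a \<bullet> dird F y u) \<Longrightarrow> tang y a = c"
  unfolding tang_def using dird_inner_eqD by (intro the_equality) auto

lemma tang_inner: "dird F y (tang y a) \<bullet> dird F y u = a \<bullet> dird F y u"
proof -
  obtain p q where pq: "p \<in> span (loc_tangent F y)"
      "\<And>w. w \<in> span (loc_tangent F y) \<Longrightarrow> orthogonal q w" "a = p + q"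
    using orthogonal_subspace_decomp_exists by blast
  have "span (loc_tangent F y) = range (dird F y)"
    using subspace_tangent by (simp add: span_eq_iff flip: loc_tangent_def)
  then have "p \<in> range (dird F y)" "\<And>u. q \<bullet> dird F y u = 0"
    using pq by (auto simp: orthogonal_def)
  then obtain c where c: "a = dird F y c + q" "\<And>u. q \<bullet> dird F y u = 0"
    using pq(3) by auto
  then have "tang y a = c" by (intro tang_eqI) (simp add: inner_add_left)
  then show ?thesis using c by (simp add: inner_add_left)
qed

lemma linear_tang: "linear (tang y)"
proof (rule linearI)
  show "tang y (a + b) = tang y a + tang y b" for a b
    by (rule tang_eqI) (simp add: linear_add[OF linear_dird] inner_add_left tang_inner)
  show "tang y (r *\<^sub>R b) = r *\<^sub>R tang y b" for r b
    by (rule tang_eqI) (simp add: linear_cmul[OF linear_dird] tang_inner)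
qed

lemma tang_dird: "tang y (dird F y c) = c"
  by (rule tang_eqI) simp

lemma normal_part_tang: "normal_part (loc_tangent F y) a = a - dird F y (tang y a)"
  by (rule normal_part_eqI[OF subspace_tangent])
     (auto simp: orthogonal_comp_iff loc_tangent_def inner_diff_left tang_inner)

lemma normal_part_inner_dird: "normal_part (loc_tangent F y) a \<bullet> dird F y u = 0"
  by (simp add: normal_part_tang inner_diff_left tang_inner)

lemma normal_part_inner_normal:
  "\<nu> \<in> orthogonal_comp (loc_tangent F y) \<Longrightarrow> normal_part (loc_tangent F y) a \<bullet> \<nu> = a \<bullet> \<nu>"
proof -
  assume "\<nu> \<in> orthogonal_comp (loc_tangent F y)"
  then have "dird F y c \<bullet> \<nu> = 0" for c
    by (auto simp: orthogonal_comp_iff loc_tangent_def inner_commute[of _ \<nu>])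
  then show ?thesis by (simp add: normal_part_tang inner_diff_left)
qed

lemma linear_normal_part: "linear (normal_part (loc_tangent F y))"
  unfolding normal_part_tang
  by (rule linearI) (simp_all add: linear_add[OF linear_tang] linear_add[OF linear_dird]
      linear_cmul[OF linear_tang] linear_cmul[OF linear_dird] scaleR_diff_right)

lemma normal_part_dird: "normal_part (loc_tangent F y) (dird F y c) = 0"
  by (simp add: normal_part_tang tang_dird)

lemma tang_normal:
  assumes "\<nu> \<in> orthogonal_comp (loc_tangent F y)"
  shows "tang y \<nu> = 0"
  using assms linear_0[OF linear_dird]
  by (intro tang_eqI) (simp add: orthogonal_comp_iff loc_tangent_def)

lemma loc_second_ff_hess: "loc_second_ff F y v w = normal_part (loc_tangent F y) (hess y v w)"
  by (simp add: loc_second_ff_def hess_def)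

lemma loc_second_ff_sym: "loc_second_ff F y v w = loc_second_ff F y w v"
  by (simp add: loc_second_ff_hess hess_sym)

lemma linear_loc_second_ff_right: "linear (loc_second_ff F y v)"
proof -
  have "loc_second_ff F y v = normal_part (loc_tangent F y) \<circ> hess y v"
    by (simp add: fun_eq_iff loc_second_ff_hess)
  then show ?thesis using linear_compose[OF linear_hess_right linear_normal_part] by simp
qed

lemma linear_loc_second_ff_left: "linear (\<lambda>v. loc_second_ff F y v w)"
proof -
  have "(\<lambda>v. loc_second_ff F y v w) = loc_second_ff F y w"
    by (simp add: fun_eq_iff loc_second_ff_sym[of w])
  then show ?thesis using linear_loc_second_ff_right by simp
qed

lemma loc_metric_has_derivative:
  "((\<lambda>z. loc_metric F z v w) has_derivative
     (\<lambda>u. dird F y v \<bullet> hess y u w + hess y u v \<bullet> dird F y w)) (at y)"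
  unfolding loc_metric_def by (intro has_derivative_inner dird_has_derivative)

text \<open>Each derivative of the metric is a sum of two terms with \<open>hess\<close>. By the
  symmetry of \<open>hess\<close>, four of the six terms in the Koszul formula cancel and the other
  two agree, so \<open>christoffel\<close> and \<open>tang\<close> are described by the same
  condition.\<close>

lemma christoffel_tang: "christoffel F y v w = tang y (hess y v w)"
proof -
  have "(dird (\<lambda>z. loc_metric F z w u) y v + dird (\<lambda>z. loc_metric F z v u) y w
      - dird (\<lambda>z. loc_metric F z v w) y u) / 2 = hess y v w \<bullet> dird F y u" for u
    unfolding dird_eqI[OF loc_metric_has_derivative]
    by (simp add: hess_sym[of w v] hess_sym[of u v] hess_sym[of u w] inner_commute)
  then show ?thesis unfolding christoffel_def tang_def loc_metric_def by presburger
qed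

end

text \<open>In the standard basis, \<open>tang y (a y)\<close> solves a linear system whose matrix
  is the Gram matrix of the coordinate vectors.\<close>

lemma tang_differentiable:
  assumes x: "x \<in> S" and a: "a differentiable (at x)"
  shows "(\<lambda>y. tang y (a y)) differentiable (at x)"
proof (rule differentiable_linear_solve[OF open_S x])
  let ?A = "\<lambda>y. \<chi> i j. dird F y (axis j 1) \<bullet> dird F y (axis i (1::real))"
  let ?b = "\<lambda>y. \<chi> i. a y \<bullet> dird F y (axis i (1::real))"
  have D: "(\<lambda>y. dird F y v) differentiable (at x)" for v
    using dird_has_derivative[OF x] by (rule differentiableI)
  show "(\<lambda>y. ?A y $ i $ j) differentiable (at x)" for i j
    by (simp add: differentiable_inner D)
  show "(\<lambda>y. ?b y $ i) differentiable (at x)" for i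
    by (simp add: differentiable_inner D a)
  have expand: "(\<Sum>j\<in>UNIV. c $ j *\<^sub>R axis j 1) = c" for c :: "real^'n"
    using basis_expansion[of c] by (simp add: scalar_mult_eq_scaleR)
  have mult: "?A y *v c = (\<chi> i. dird F y c \<bullet> dird F y (axis i 1))" if "y \<in> S" for y c
  proof -
    have "dird F y c = dird F y (\<Sum>j\<in>UNIV. c $ j *\<^sub>R axis j 1)"
      by (simp only: expand)
    then have "dird F y c = (\<Sum>j\<in>UNIV. c $ j *\<^sub>R dird F y (axis j 1))"
      by (simp add: linear_sum[OF linear_dird[OF that]] linear_cmul[OF linear_dird[OF that]])
    then show ?thesis
      by (simp add: matrix_vector_mult_def vec_eq_iff inner_sum_left mult.commute)
  qed
  show "?A y *v tang y (a y) = ?b y" if "y \<in> S" for y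
    using mult[OF that] tang_inner[OF that] by simp
  \<comment> \<open>If the Gram matrix annihilates a vector, the image of that vector under
    \<open>dird F y\<close> is orthogonal to the whole tangent space, hence zero, and the
    differential is injective.\<close>
  show "det (?A y) \<noteq> 0" if y: "y \<in> S" for y
  proof -
    have "inj ((*v) (?A y))"
    proof (rule injI)
      fix c c' assume "?A y *v c = ?A y *v c'"
      then have "?A y *v (c - c') = 0" by (simp add: matrix_vector_mult_diff_distrib)
      then have 0: "dird F y (c - c') \<bullet> dird F y (axis i 1) = 0" for i
        using mult[OF y] by (simp add: vec_eq_iff)
      have "dird F y (c - c') \<bullet> dird F y u = 0" for u
      proof -
        have "dird F y u = dird F y (\<Sum>j\<in>UNIV. u $ j *\<^sub>R axis j 1)"
          by (simp only: expand)
        then show ?thesis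
          by (simp add: linear_sum[OF linear_dird[OF y]] linear_cmul[OF linear_dird[OF y]]
              inner_sum_right 0)
      qed
      then show "c = c'"
        using dird_inner_eqD[OF y] by (simp add: linear_diff[OF linear_dird[OF y]] inner_diff_left)
    qed
    then show ?thesis
      using matrix_left_invertible_injective invertible_left_inverse invertible_det_nz by blast
  qed
qed

end

section \<open>The Gauss and Ricci equations\<close>

context immersed_patch begin

lemma dird_field_has_derivative:
  assumes "x \<in> S" "(Z has_derivative Z') (at x)"
  shows "((\<lambda>y. dird F y (Z y)) has_derivative (\<lambda>v. dird F x (Z' v) + hess x v (Z x))) (at x)"
  using dird_along_field_has_derivative[OF open_S smooth assms] unfolding hess_def .

text \<open>With \<open>Z\<close> the Christoffel field of \<open>w\<close> and \<open>z\<close>,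
  the product \<open>dird F y (Z y) \<bullet> dird F y t\<close> is differentiated in two ways: as
  it stands, and with \<open>dird F y (Z y)\<close> replaced by \<open>hess y w z\<close>.
  Comparison eliminates the derivative of \<open>Z\<close>. What is left pairs the normal part of
  \<open>hess x w z\<close> with \<open>hess x v t\<close>, of which only the normal part
  counts.\<close>

lemma loc_nabla_nabla_inner:
  assumes x: "x \<in> S"
  shows "dird F x (loc_nabla F v (loc_nabla F w (\<lambda>_. z)) x) \<bullet> dird F x t
    = dird (\<lambda>y. hess y w z) x v \<bullet> dird F x t + loc_second_ff F x w z \<bullet> loc_second_ff F x v t"
proof -
  define Z where "Z y = tang y (hess y w z)" for y
  have hess_der: "((\<lambda>y. hess y w z) has_derivative dird (\<lambda>y. hess y w z) x) (at x)"
    unfolding hess_def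
    using smooth_on_has_derivative[OF smooth_on_dird[OF smooth_on_dird[OF smooth]] x] .
  have nabla_Z: "loc_nabla F w (\<lambda>_. z) y = Z y" if "y \<in> S" for y
    using that by (simp add: loc_nabla_def christoffel_tang Z_def)
  obtain Z' where Z': "(Z has_derivative Z') (at x)"
    using tang_differentiable[OF x differentiableI[OF hess_der]]
    unfolding Z_def differentiable_def by blast
  have "((\<lambda>y. loc_nabla F w (\<lambda>_. z) y) has_derivative Z') (at x)"
    using has_derivative_transform_within_open[OF Z' open_S x] nabla_Z by metis
  then have nabla: "loc_nabla F v (loc_nabla F w (\<lambda>_. z)) x = Z' v + tang x (hess x v (Z x))"
    using x by (simp add: loc_nabla_def[of F v] dird_eqI nabla_Z christoffel_tang)
  have "((\<lambda>y. dird F y (Z y) \<bullet> dird F y t) has_derivative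
      (\<lambda>v. dird F x (Z x) \<bullet> hess x v t + (dird F x (Z' v) + hess x v (Z x)) \<bullet> dird F x t)) (at x)"
    by (intro has_derivative_inner dird_field_has_derivative dird_has_derivative x Z')
  moreover have "((\<lambda>y. dird F y (Z y) \<bullet> dird F y t) has_derivative
      (\<lambda>v. hess x w z \<bullet> hess x v t + dird (\<lambda>y. hess y w z) x v \<bullet> dird F x t)) (at x)"
  proof (rule has_derivative_transform_within_open[OF _ open_S x])
    show "((\<lambda>y. hess y w z \<bullet> dird F y t) has_derivative
      (\<lambda>v. hess x w z \<bullet> hess x v t + dird (\<lambda>y. hess y w z) x v \<bullet> dird F x t)) (at x)"
      by (intro has_derivative_inner dird_has_derivative x hess_der)
  qed (simp add: Z_def tang_inner)
  ultimately have "(\<lambda>v. dird F x (Z x) \<bullet> hess x v t + (dird F x (Z' v) + hess x v (Z x)) \<bullet> dird F x t)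
      = (\<lambda>v. hess x w z \<bullet> hess x v t + dird (\<lambda>y. hess y w z) x v \<bullet> dird F x t)"
    by (rule has_derivative_unique)
  then have "dird F x (Z x) \<bullet> hess x v t + (dird F x (Z' v) + hess x v (Z x)) \<bullet> dird F x t
      = hess x w z \<bullet> hess x v t + dird (\<lambda>y. hess y w z) x v \<bullet> dird F x t"
    by meson
  moreover have "loc_second_ff F x w z \<bullet> loc_second_ff F x v t
      = (hess x w z - dird F x (Z x)) \<bullet> hess x v t"
  proof -
    have "loc_second_ff F x w z \<in> orthogonal_comp (loc_tangent F x)"
      using x by (auto simp: loc_second_ff_hess orthogonal_comp_iff loc_tangent_def
          normal_part_inner_dird[unfolded loc_tangent_def])
    from normal_part_inner_normal[OF x this, of "hess x v t"]
    have "loc_second_ff F x w z \<bullet> loc_second_ff F x v t = loc_second_ff F x w z \<bullet> hess x v t"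
      by (simp add: loc_second_ff_hess[OF x, of v t] inner_commute)
    then show ?thesis by (simp add: loc_second_ff_hess x normal_part_tang Z_def)
  qed
  ultimately show ?thesis
    unfolding nabla
    by (simp add: linear_add[OF linear_dird[OF x]] inner_add_left tang_inner x inner_diff_left)
qed

text \<open>The third derivatives of \<open>F\<close> are symmetric in \<open>v\<close> and
  \<open>w\<close> and cancel, so only products of second fundamental forms survive.\<close>

theorem gauss_equation:
  assumes x: "x \<in> S"
  shows "dird F x (loc_curvature F v w (\<lambda>_. z) x) \<bullet> dird F x t
    = loc_second_ff F x w z \<bullet> loc_second_ff F x v t - loc_second_ff F x v z \<bullet> loc_second_ff F x w t"
proof -
  have "dird (\<lambda>y. hess y w z) x v = dird (\<lambda>y. hess y v z) x w"
    unfolding hess_def using dird_dird_commute[OF open_S smooth_on_dird[OF smooth] x] .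
  then show ?thesis
    by (simp add: loc_curvature_def linear_diff[OF linear_dird[OF x]] inner_diff_left
        loc_nabla_nabla_inner[OF x])
qed

text \<open>
  With \<open>c y = tang y u\<close>, which vanishes at \<open>x\<close> for normal \<open>u\<close>, the extension of \<open>u\<close> is \<open>u - dF c\<close>.
  The derivative of \<open>c\<close> at \<open>x\<close> is the shape operator of \<open>u\<close>, and no second derivative of \<open>c\<close>
  enters, since the projection kills the tangential term \<open>dF (dc w)\<close>.
\<close>

lemma loc_nabla_perp_nabla_perp:
  assumes x: "x \<in> S" and u: "u \<in> orthogonal_comp (loc_tangent F x)"
  obtains A where "\<And>v t. dird F x (A v) \<bullet> dird F x t = loc_second_ff F x v t \<bullet> u"
    "\<And>v w. loc_nabla_perp F v (loc_nabla_perp F w (\<lambda>y. normal_part (loc_tangent F y) u)) x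
       = - loc_second_ff F x w (A v)"
proof -
  define c where "c y = tang y u" for y
  have diff: "c differentiable (at y)" if "y \<in> S" for y
    unfolding c_def using tang_differentiable[OF that differentiable_const] .
  then have c: "(c has_derivative dird c y) (at y)" if "y \<in> S" for y
    using that frechet_derivative_works by blast
  have cx: "c x = 0" unfolding c_def using tang_normal[OF x u] .
  have shape: "dird F x (dird c x v) \<bullet> dird F x t = loc_second_ff F x v t \<bullet> u" for v t
  proof -
    have "((\<lambda>y. dird F y (c y) \<bullet> dird F y t) has_derivative
        (\<lambda>v. dird F x (c x) \<bullet> hess x v t + (dird F x (dird c x v) + hess x v (c x)) \<bullet> dird F x t)) (at x)"
      by (intro has_derivative_inner dird_field_has_derivative dird_has_derivative x c)
    moreover have "((\<lambda>y. dird F y (c y) \<bullet> dird F y t) has_derivative (\<lambda>v. u \<bullet> hess x v t)) (at x)"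
    proof (rule has_derivative_transform_within_open[OF _ open_S x])
      show "((\<lambda>y. u \<bullet> dird F y t) has_derivative (\<lambda>v. u \<bullet> hess x v t)) (at x)"
        by (intro has_derivative_inner_right dird_has_derivative x)
    qed (simp add: c_def tang_inner)
    ultimately have "(\<lambda>v. dird F x (c x) \<bullet> hess x v t
        + (dird F x (dird c x v) + hess x v (c x)) \<bullet> dird F x t) = (\<lambda>v. u \<bullet> hess x v t)"
      by (rule has_derivative_unique)
    from fun_cong[OF this, of v]
    have "dird F x (dird c x v) \<bullet> dird F x t = u \<bullet> hess x v t"
      by (simp add: cx linear_0[OF linear_dird[OF x]] linear_0[OF linear_hess_right[OF x]])
    then show ?thesis
      by (simp add: loc_second_ff_hess x normal_part_inner_normal[OF x u] inner_commute[of u])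
  qed
  have perp: "loc_nabla_perp F v (loc_nabla_perp F w (\<lambda>y. normal_part (loc_tangent F y) u)) x
       = - loc_second_ff F x w (dird c x v)" for v w
  proof -
    let ?\<xi> = "\<lambda>y. normal_part (loc_tangent F y) u"
    define q where "q y = hess y w (c y)" for y
    have \<xi>: "dird ?\<xi> y w = - (dird F y (dird c y w) + q y)" if y: "y \<in> S" for y
    proof -
      have "((\<lambda>y. u - dird F y (c y)) has_derivative (\<lambda>v. 0 - (dird F y (dird c y v) + hess y v (c y)))) (at y)"
        by (intro has_derivative_diff has_derivative_const dird_field_has_derivative c y)
      then have "(?\<xi> has_derivative (\<lambda>v. 0 - (dird F y (dird c y v) + hess y v (c y)))) (at y)"
        by (rule has_derivative_transform_within_open[OF _ open_S y]) (simp add: normal_part_tang c_def)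
      then show ?thesis by (simp add: dird_eqI q_def)
    qed
    have nab: "loc_nabla_perp F w ?\<xi> y = dird F y (tang y (q y)) - q y" if y: "y \<in> S" for y
      unfolding loc_nabla_perp_def \<xi>[OF y]
      by (simp add: linear_neg[OF linear_normal_part[OF y]] linear_add[OF linear_normal_part[OF y]]
          normal_part_dird[OF y] normal_part_tang[OF y, of "q y"] del: minus_add_distrib)
    have q0: "q x = 0" by (simp add: q_def cx linear_0[OF linear_hess_right[OF x]])
    \<comment> \<open>The product rule expects the field in the slot of the last differentiation,
      and \<open>hess_sym\<close> allows \<open>c\<close> to be moved there. As \<open>c\<close>
      vanishes at \<open>x\<close>, only its derivative contributes.\<close>
    have qder: "(q has_derivative (\<lambda>v. hess x w (dird c x v))) (at x)"
    proof -
      have "((\<lambda>y. dird (\<lambda>z. dird F z w) y (c y)) has_derivative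
         (\<lambda>v. dird (\<lambda>z. dird F z w) x (dird c x v) + dird (\<lambda>y. dird (\<lambda>z. dird F z w) y (c x)) x v)) (at x)"
        by (rule dird_along_field_has_derivative[OF open_S smooth_on_dird[OF smooth] x c[OF x]])
      moreover have "dird (\<lambda>y. dird (\<lambda>z. dird F z w) y 0) x v = 0" for v
      proof -
        have "((\<lambda>y. dird (\<lambda>z. dird F z w) y 0) has_derivative (\<lambda>_. 0)) (at x)"
          by (rule has_derivative_transform_within_open[OF has_derivative_const[of 0] open_S x])
             (simp add: linear_0[OF smooth_on_linear_dird[OF smooth_on_dird[OF smooth]]])
        then show ?thesis by (simp add: dird_eqI)
      qed
      ultimately have "((\<lambda>y. dird (\<lambda>z. dird F z w) y (c y)) has_derivative
         (\<lambda>v. hess x (dird c x v) w)) (at x)" by (simp add: cx hess_def)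
      then have "(q has_derivative (\<lambda>v. hess x (dird c x v) w)) (at x)"
        by (rule has_derivative_transform_within_open[OF _ open_S x])
           (use hess_sym in \<open>simp add: q_def flip: hess_def\<close>)
      then show ?thesis by (simp add: hess_sym[OF x, of w])
    qed
    \<comment> \<open>Only the existence of \<open>T'\<close> matters: it enters through a
      tangential vector, which the final normal projection removes.\<close>
    obtain T' where T': "((\<lambda>y. tang y (q y)) has_derivative T') (at x)"
      using tang_differentiable[OF x differentiableI[OF qder]] unfolding differentiable_def by blast
    have "((\<lambda>y. dird F y (tang y (q y)) - q y) has_derivative
        (\<lambda>v. (dird F x (T' v) + hess x v (tang x (q x))) - hess x w (dird c x v))) (at x)"
      by (intro has_derivative_diff dird_field_has_derivative x T' qder)
    then have "(loc_nabla_perp F w ?\<xi> has_derivative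
        (\<lambda>v. (dird F x (T' v) + hess x v (tang x (q x))) - hess x w (dird c x v))) (at x)"
      by (rule has_derivative_transform_within_open[OF _ open_S x]) (simp add: nab)
    then have "dird (loc_nabla_perp F w ?\<xi>) x v = dird F x (T' v) - hess x w (dird c x v)"
      by (simp add: dird_eqI q0 linear_0[OF linear_tang[OF x]] linear_0[OF linear_hess_right[OF x]])
    then show ?thesis
      by (simp add: loc_nabla_perp_def[of F v] linear_diff[OF linear_normal_part[OF x]]
          normal_part_dird[OF x] loc_second_ff_hess[OF x])
  qed
  show thesis
    by (rule that[OF shape perp])
qed

text \<open>\<open>A\<close> is the shape operator of \<open>u\<close> in coordinates. It is
  specified by inner products, the form in which it can be expanded in an orthonormal basis.\<close>

theorem ricci_equation:
  assumes x: "x \<in> S" and u: "u \<in> orthogonal_comp (loc_tangent F x)"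
  obtains A where "\<And>v t. dird F x (A v) \<bullet> dird F x t = loc_second_ff F x v t \<bullet> u"
    "\<And>v w. loc_curvature_perp F v w (\<lambda>y. normal_part (loc_tangent F y) u) x
       = loc_second_ff F x v (A w) - loc_second_ff F x w (A v)"
  by (rule loc_nabla_perp_nabla_perp[OF assms])
     (rule that, auto simp: loc_curvature_perp_def)

end

section \<open>Sums over orthonormal bases\<close>

lemma orthonormal_basis_expansion:
  assumes "orthonormal_basis m V e" "X \<in> V"
  shows "X = (\<Sum>k=1..m. (X \<bullet> e k) *\<^sub>R e k)"
proof -
  have "X \<in> span (e ` {1..m})" using assms by (simp add: orthonormal_basis_def)
  then show ?thesis
  proof (induction rule: span_induct)
    case base
    have "linear (\<lambda>X. X - (\<Sum>k=1..m. (X \<bullet> e k) *\<^sub>R e k))"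
      by (rule linearI)
         (simp_all add: inner_add_left scaleR_add_left sum.distrib scaleR_sum_right scaleR_diff_right)
    from linear_subspace_vimage[OF this subspace_single_0] show ?case
      by (simp add: vimage_def)
  next
    case (step x)
    then obtain i where i: "i \<in> {1..m}" "x = e i" by blast
    have "(\<Sum>k=1..m. (e i \<bullet> e k) *\<^sub>R e k) = (\<Sum>k=1..m. if i = k then e k else 0)"
      using assms i by (intro sum.cong) (auto simp: orthonormal_basis_def)
    then show ?case using i by simp
  qed
qed

lemma orthonormal_basis_mem: "orthonormal_basis m V e \<Longrightarrow> i \<in> {1..m} \<Longrightarrow> e i \<in> V"
  unfolding orthonormal_basis_def using span_base by blast

lemma orthonormal_basis_inner:
  "orthonormal_basis m V e \<Longrightarrow> i \<in> {1..m} \<Longrightarrow> j \<in> {1..m} \<Longrightarrow> e i \<bullet> e j = (if i = j then 1 else 0)"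
  unfolding orthonormal_basis_def by blast

text \<open>The matrix of \<open>e i \<bullet> E k\<close> has orthonormal columns, as follows by
  expanding \<open>E k\<close> in the basis \<open>e\<close> and pairing with \<open>E l\<close>.
  The values of \<open>B\<close> may be vectors, so that the trace of the second fundamental form
  itself is covered.\<close>

lemma trace_orthonormal_basis:
  fixes B :: "'a::euclidean_space \<Rightarrow> 'a \<Rightarrow> 'c::real_vector"
  assumes e: "orthonormal_basis m V e" and E: "orthonormal_basis m V E"
    and B: "\<And>X. linear (B X)" "\<And>Y. linear (\<lambda>X. B X Y)"
  shows "(\<Sum>i=1..m. B (e i) (e i)) = (\<Sum>k=1..m. B (E k) (E k))"
proof -
  let ?I = "{1..m}"
  have "B (e i) (e i) = (\<Sum>k\<in>?I. \<Sum>l\<in>?I. ((e i \<bullet> E k) * (e i \<bullet> E l)) *\<^sub>R B (E k) (E l))"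
    if "i \<in> ?I" for i
  proof -
    note ex = orthonormal_basis_expansion[OF E orthonormal_basis_mem[OF e that]]
    have "B (e i) (e i) = (\<Sum>k\<in>?I. (e i \<bullet> E k) *\<^sub>R B (E k) (e i))"
      by (subst (1) ex) (simp add: linear_sum[OF B(2)] linear_cmul[OF B(2)])
    moreover have "B (E k) (e i) = (\<Sum>l\<in>?I. (e i \<bullet> E l) *\<^sub>R B (E k) (E l))" for k
      by (subst (1) ex) (simp add: linear_sum[OF B(1)] linear_cmul[OF B(1)])
    ultimately show ?thesis by (simp add: scaleR_sum_right)
  qed
  then have "(\<Sum>i\<in>?I. B (e i) (e i))
      = (\<Sum>i\<in>?I. \<Sum>k\<in>?I. \<Sum>l\<in>?I. ((e i \<bullet> E k) * (e i \<bullet> E l)) *\<^sub>R B (E k) (E l))"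
    by simp
  also have "\<dots> = (\<Sum>k\<in>?I. \<Sum>i\<in>?I. \<Sum>l\<in>?I. ((e i \<bullet> E k) * (e i \<bullet> E l)) *\<^sub>R B (E k) (E l))"
    by (rule sum.swap)
  also have "\<dots> = (\<Sum>k\<in>?I. \<Sum>l\<in>?I. \<Sum>i\<in>?I. ((e i \<bullet> E k) * (e i \<bullet> E l)) *\<^sub>R B (E k) (E l))"
    by (rule sum.cong[OF refl]) (rule sum.swap)
  also have "\<dots> = (\<Sum>k\<in>?I. \<Sum>l\<in>?I. (if k = l then 1 else 0) *\<^sub>R B (E k) (E l))"
  proof (intro sum.cong refl)
    fix k l assume kl: "k \<in> ?I" "l \<in> ?I"
    have "E k \<bullet> E l = (\<Sum>i\<in>?I. (E k \<bullet> e i) *\<^sub>R e i) \<bullet> E l"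
      using orthonormal_basis_expansion[OF e orthonormal_basis_mem[OF E kl(1)]] by simp
    then have "(\<Sum>i\<in>?I. (e i \<bullet> E k) * (e i \<bullet> E l)) = (if k = l then 1 else 0)"
      using orthonormal_basis_inner[OF E kl] by (simp add: inner_sum_left inner_commute[of "E k"])
    then show "(\<Sum>i\<in>?I. ((e i \<bullet> E k) * (e i \<bullet> E l)) *\<^sub>R B (E k) (E l))
        = (if k = l then 1 else 0) *\<^sub>R B (E k) (E l)"
      by (simp flip: scaleR_sum_left)
  qed
  also have "\<dots> = (\<Sum>k\<in>?I. \<Sum>l\<in>?I. if k = l then B (E k) (E l) else 0)"
    by (intro sum.cong refl) auto
  also have "\<dots> = (\<Sum>k\<in>?I. B (E k) (E k))" by simp
  finally show ?thesis .
qed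

text \<open>For each \<open>k\<close> this is the trace of the form
  \<open>L k X \<bullet> L k Y\<close>. The index set \<open>K\<close> carries what is held fixed
  while one slot changes its basis.\<close>

lemma sum_norm2_orthonormal_basis:
  fixes L :: "'k \<Rightarrow> 'a::euclidean_space \<Rightarrow> 'c::real_inner"
  assumes "orthonormal_basis m V e" "orthonormal_basis m V E" "\<And>k. linear (L k)"
  shows "(\<Sum>i=1..m. \<Sum>k\<in>K. L k (e i) \<bullet> L k (e i)) = (\<Sum>i=1..m. \<Sum>k\<in>K. L k (E i) \<bullet> L k (E i))"
proof -
  have "(\<Sum>i=1..m. L k (e i) \<bullet> L k (e i)) = (\<Sum>i=1..m. L k (E i) \<bullet> L k (E i))" for k
    by (rule trace_orthonormal_basis[OF assms(1,2)])
       (auto intro!: linearI simp: linear_add[OF assms(3)] linear_cmul[OF assms(3)] inner_add_left inner_add_right)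
  then show ?thesis by (subst (1 2) sum.swap) simp
qed

lemma sum_norm2_two_orthonormal_bases:
  fixes L :: "'k \<Rightarrow> 'a::euclidean_space \<Rightarrow> 'b::euclidean_space \<Rightarrow> 'c::real_inner"
  assumes e: "orthonormal_basis m V e" "orthonormal_basis m V E"
    and u: "orthonormal_basis l W u" "orthonormal_basis l W U"
    and L: "\<And>k X. linear (L k X)" "\<And>k Y. linear (\<lambda>X. L k X Y)"
  shows "(\<Sum>i=1..m. \<Sum>j=1..l. \<Sum>k\<in>K. L k (e i) (u j) \<bullet> L k (e i) (u j))
    = (\<Sum>i=1..m. \<Sum>j=1..l. \<Sum>k\<in>K. L k (E i) (U j) \<bullet> L k (E i) (U j))"
proof -
  have "(\<Sum>i=1..m. \<Sum>j=1..l. \<Sum>k\<in>K. L k (e i) (u j) \<bullet> L k (e i) (u j))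
      = (\<Sum>i=1..m. \<Sum>j=1..l. \<Sum>k\<in>K. L k (e i) (U j) \<bullet> L k (e i) (U j))"
    by (rule sum.cong[OF refl], rule sum_norm2_orthonormal_basis[OF u L(1)])
  also have "\<dots> = (\<Sum>j=1..l. \<Sum>i=1..m. \<Sum>k\<in>K. L k (e i) (U j) \<bullet> L k (e i) (U j))"
    by (rule sum.swap)
  also have "\<dots> = (\<Sum>j=1..l. \<Sum>i=1..m. \<Sum>k\<in>K. L k (E i) (U j) \<bullet> L k (E i) (U j))"
    by (rule sum.cong[OF refl], rule sum_norm2_orthonormal_basis[OF e L(2)])
  also have "\<dots> = (\<Sum>i=1..m. \<Sum>j=1..l. \<Sum>k\<in>K. L k (E i) (U j) \<bullet> L k (E i) (U j))"
    by (rule sum.swap)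
  finally show ?thesis .
qed

text \<open>The normal bases are exchanged first. The pair of normal indices then becomes the index
  of a family of maps in the two tangential slots.\<close>

lemma sum_norm2_four_orthonormal_bases:
  fixes Q :: "'a::euclidean_space \<Rightarrow> 'a \<Rightarrow> 'b::euclidean_space \<Rightarrow> 'b \<Rightarrow> 'c::real_inner"
  assumes e: "orthonormal_basis m V e" "orthonormal_basis m V E"
    and u: "orthonormal_basis l W u" "orthonormal_basis l W U"
    and Q: "\<And>Y a b. linear (\<lambda>X. Q X Y a b)" "\<And>X a b. linear (\<lambda>Y. Q X Y a b)"
      "\<And>X Y b. linear (\<lambda>a. Q X Y a b)" "\<And>X Y a. linear (\<lambda>b. Q X Y a b)"
  shows "(\<Sum>i=1..m. \<Sum>j=1..m. \<Sum>a=1..l. \<Sum>b=1..l. Q (e i) (e j) (u a) (u b) \<bullet> Q (e i) (e j) (u a) (u b))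
    = (\<Sum>i=1..m. \<Sum>j=1..m. \<Sum>a=1..l. \<Sum>b=1..l. Q (E i) (E j) (U a) (U b) \<bullet> Q (E i) (E j) (U a) (U b))"
proof -
  let ?K = "{1..l} \<times> {1..l}"
  have "(\<Sum>a=1..l. \<Sum>b=1..l. Q X Y (u a) (u b) \<bullet> Q X Y (u a) (u b))
      = (\<Sum>a=1..l. \<Sum>b=1..l. Q X Y (U a) (U b) \<bullet> Q X Y (U a) (U b))" for X Y
    using sum_norm2_two_orthonormal_bases[OF u u, of "\<lambda>_. Q X Y" "{()}"] Q(3,4) by simp
  moreover have "(\<Sum>i=1..m. \<Sum>j=1..m. \<Sum>k\<in>?K. Q (e i) (e j) (U (fst k)) (U (snd k)) \<bullet> Q (e i) (e j) (U (fst k)) (U (snd k)))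
    = (\<Sum>i=1..m. \<Sum>j=1..m. \<Sum>k\<in>?K. Q (E i) (E j) (U (fst k)) (U (snd k)) \<bullet> Q (E i) (E j) (U (fst k)) (U (snd k)))"
    by (rule sum_norm2_two_orthonormal_bases[OF e e]) (rule Q)+
  ultimately show ?thesis by (simp add: sum.cartesian_product split_beta)
qed

text \<open>Basis changes act on full double sums, while the curvatures are defined by sums over
  \<open>i < j\<close>; this is the passage between them. The induction adds one row and one
  column.\<close>

lemma sum_square_eq_diagonal_plus_triangle:
  fixes g :: "nat \<Rightarrow> nat \<Rightarrow> real"
  assumes sym: "\<And>i j. i \<in> {1..n} \<Longrightarrow> j \<in> {1..n} \<Longrightarrow> g i j = g j i"
  shows "(\<Sum>i=1..n. \<Sum>j=1..n. g i j) = (\<Sum>i=1..n. g i i) + 2 * (\<Sum>i=1..n. \<Sum>j\<in>{i<..n}. g i j)"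
  using assms
proof (induction n)
  case (Suc n)
  have "(\<Sum>i=1..n. \<Sum>j\<in>{i<..Suc n}. g i j) = (\<Sum>i=1..n. g i (Suc n) + (\<Sum>j\<in>{i<..n}. g i j))"
  proof (rule sum.cong[OF refl])
    fix i assume "i \<in> {1..n}"
    then have "{i<..Suc n} = insert (Suc n) {i<..n}" by auto
    then show "(\<Sum>j\<in>{i<..Suc n}. g i j) = g i (Suc n) + (\<Sum>j\<in>{i<..n}. g i j)" by simp
  qed
  moreover have "(\<Sum>j=1..n. g (Suc n) j) = (\<Sum>j=1..n. g j (Suc n))"
    by (intro sum.cong refl Suc.prems) auto
  ultimately show ?case using Suc by (simp add: sum.distrib)
qed simp

text \<open>The first row and column have \<open>2 * (n - 1)\<close> off-diagonal entries, the
  remaining block \<open>(n - 1) * (n - 2)\<close>.\<close>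

lemma sum_off_diagonal:
  fixes b c :: real
  assumes "n \<ge> 1"
  shows "(\<Sum>i=1..n. \<Sum>j=1..n. if i = j then 0 else if i = 1 \<or> j = 1 then b else c)
    = 2 * (real n - 1) * b + (real n - 1) * (real n - 2) * c"
proof -
  have split: "(\<Sum>i=1..n. G i) = G 1 + (\<Sum>i=2..n. G i)" for G :: "nat \<Rightarrow> real"
    using assms sum.atLeast_Suc_atMost[of 1 n G] by (simp add: numeral_2_eq_2)
  have "(\<Sum>j=2..n. if i = j then 0 else c) = (real n - 2) * c" if "i \<in> {2..n}" for i
  proof -
    have "(\<Sum>j=2..n. if i = j then 0 else c) = (\<Sum>j=2..n. c - (if i = j then c else 0))"
      by (intro sum.cong) auto
    also have "\<dots> = real (n - 1) * c - c" using that by (simp add: sum_subtractf)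
    finally show ?thesis using that by (simp add: of_nat_diff algebra_simps)
  qed
  then have "(\<Sum>i=2..n. \<Sum>j=2..n. if i = j then 0 else c) = (real n - 1) * ((real n - 2) * c)"
    using assms by (simp add: of_nat_diff)
  moreover have "(\<Sum>j=1..n. if i = j then 0 else if i = 1 \<or> j = 1 then b else c)
      = b + (\<Sum>j=2..n. if i = j then 0 else c)" if "i \<in> {2..n}" for i
    using that by (subst split) (auto intro!: sum.cong)
  moreover have "(\<Sum>j=1..n. if 1 = j then 0 else if (1::nat) = 1 \<or> j = 1 then b else c) = (real n - 1) * b"
    using assms by (subst split) (simp add: of_nat_diff)
  ultimately show ?thesis
    using assms by (subst split) (simp add: sum.distrib of_nat_diff algebra_simps)
qed

text \<open>\<open>N\<close>, \<open>l\<close> and \<open>m\<close> stand for the dimension,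
  \<open>lam\<close> and \<open>mu\<close>; unlike in the overview, \<open>m\<close> is
  \<open>mu\<close> itself and not its square. \<open>D\<close> is the sum under the root in the
  normal scalar curvature.\<close>

lemma umbilical_scalar_inequality:
  fixes N l m :: real
  assumes "N \<ge> 2"
  defines "D \<equiv> (N - 1) * (m * (l - m))\<^sup>2 + (N - 1) * (N - 2) / 2 * (m\<^sup>2)\<^sup>2"
  shows "(2 * l * m + (N - 4) * m\<^sup>2) / N \<le> ((l + (N - 1) * m) / N)\<^sup>2 - 2 / (N * (N - 1)) * sqrt D" (is ?le)
    and "N \<ge> 3 \<Longrightarrow> (2 * l * m + (N - 4) * m\<^sup>2) / N = ((l + (N - 1) * m) / N)\<^sup>2 - 2 / (N * (N - 1)) * sqrt D
      \<Longrightarrow> l = 0 \<and> m = 0"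
proof -
  define X where "X = (l - m)\<^sup>2 + 2 * N * m\<^sup>2"
  have gap: "((l + (N - 1) * m) / N)\<^sup>2 - (2 * l * m + (N - 4) * m\<^sup>2) / N = X / N\<^sup>2"
    using assms(1) by (simp add: X_def field_simps power2_eq_square)
  \<comment> \<open>The square is completed in \<open>(l - m)\<^sup>2\<close>. The factor
    \<open>N - 2\<close> of the remainder decides both its sign and what equality implies.\<close>
  have id: "((N - 1) * X)\<^sup>2 - 4 * N\<^sup>2 * D
      = ((N - 1) * (l - m)\<^sup>2 - 2 * N * m\<^sup>2)\<^sup>2 + 2 * N\<^sup>2 * ((N - 2) * (N + 1)) * (m\<^sup>2)\<^sup>2"
    unfolding X_def D_def power_mult_distrib by (simp add: field_simps) algebra
  have X: "X \<ge> 0" using assms(1) by (simp add: X_def)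
  have D: "D \<ge> 0" using assms(1) by (simp add: D_def)
  have rhs: "0 \<le> 2 * N\<^sup>2 * ((N - 2) * (N + 1)) * (m\<^sup>2)\<^sup>2"
    using assms(1) by simp
  then have "4 * N\<^sup>2 * D \<le> ((N - 1) * X)\<^sup>2" using id by (smt (verit) zero_le_power2)
  then have "sqrt (4 * N\<^sup>2 * D) \<le> (N - 1) * X"
    using X assms(1) by (intro real_le_lsqrt) auto
  then have "2 * N * sqrt D \<le> (N - 1) * X"
    using assms(1) by (simp add: real_sqrt_mult)
  then have "2 * N * sqrt D / (N\<^sup>2 * (N - 1)) \<le> (N - 1) * X / (N\<^sup>2 * (N - 1))"
    using assms(1) by (intro divide_right_mono) auto
  then have "2 / (N * (N - 1)) * sqrt D \<le> X / N\<^sup>2"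
    using assms(1) by (simp add: power2_eq_square)
  then show ?le using gap by linarith
  assume "N \<ge> 3" and eq: "(2 * l * m + (N - 4) * m\<^sup>2) / N
    = ((l + (N - 1) * m) / N)\<^sup>2 - 2 / (N * (N - 1)) * sqrt D"
  have "2 / (N * (N - 1)) * sqrt D = X / N\<^sup>2" using eq gap by linarith
  then have "N * ((N - 1) * X) = N * (2 * N * sqrt D)"
    using assms(1) by (simp add: field_simps power2_eq_square)
  then have XD: "(N - 1) * X = 2 * N * sqrt D" using assms(1) by simp
  have "((N - 1) * X)\<^sup>2 = 4 * N\<^sup>2 * D"
    unfolding XD using D by (simp add: power_mult_distrib)
  \<comment> \<open>Two nonnegative terms add up to zero. For \<open>N \<ge> 3\<close> the first has
    a positive coefficient and forces \<open>m = 0\<close>; the second then gives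
    \<open>l = m\<close>.\<close>
  then have "2 * N\<^sup>2 * ((N - 2) * (N + 1)) * (m\<^sup>2)\<^sup>2 = 0"
      "((N - 1) * (l - m)\<^sup>2 - 2 * N * m\<^sup>2)\<^sup>2 = 0"
    using id rhs zero_le_power2[of "(N - 1) * (l - m)\<^sup>2 - 2 * N * m\<^sup>2"] by linarith+
  then show "l = 0 \<and> m = 0" using \<open>N \<ge> 3\<close> by auto
qed

section \<open>The second fundamental form at a point\<close>

text \<open>The pointwise notions select a chart by \<open>SOME\<close>. The image of that chart is
  an open set on which the local theory applies.\<close>

lemma immersed_patch_param_at:
  fixes \<A> :: "('m, 'n::finite) chart set" and f :: "'m \<Rightarrow> 'b::euclidean_space"
  assumes M: "smooth_manifold M \<A>" and f: "immersion M \<A> f" and p: "p \<in> topspace M"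
  obtains S where "immersed_patch S (param_at \<A> f p)" "pos_at \<A> p \<in> S"
proof -
  obtain U \<phi> where c: "chart_at \<A> p = (U, \<phi>)" by (cases "chart_at \<A> p")
  have "\<exists>c. c \<in> \<A> \<and> p \<in> fst c"
    using M p unfolding smooth_manifold_def by blast
  from someI_ex[OF this] have U: "(U, \<phi>) \<in> \<A>" "p \<in> U"
    using c unfolding chart_at_def by auto
  have "openin M U" "open (\<phi> ` U)" using M U(1) unfolding smooth_manifold_def by auto
  then have UM: "U \<inter> topspace M = U" using openin_subset by blast
  have "smooth_on (\<phi> ` U) (param_at \<A> f p)"
    using f U(1) UM unfolding immersion_def smooth_map_on_def param_at_def c by fastforce
  moreover have "inj (dird (param_at \<A> f p) y)" if "y \<in> \<phi> ` U" for y
    using f U(1) that unfolding immersion_def param_at_def c by fastforce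
  ultimately have "immersed_patch (\<phi> ` U) (param_at \<A> f p)"
    using \<open>open (\<phi> ` U)\<close> by unfold_locales
  moreover have "pos_at \<A> p \<in> \<phi> ` U" using U(2) by (simp add: pos_at_def c)
  ultimately show thesis using that by blast
qed

text \<open>
  \<open>second_ff\<close> is meaningful on tangent vectors only; \<open>h\<close> is its composition with the tangential
  projection, hence bilinear on the whole ambient space.
\<close>

lemma second_ff_extension:
  fixes \<A> :: "('m, 'n::finite) chart set" and f :: "'m \<Rightarrow> 'b::euclidean_space"
  assumes "smooth_manifold M \<A>" "immersion M \<A> f" "p \<in> topspace M"
  obtains h where
    "\<And>X. linear (h X)" "\<And>Y. linear (\<lambda>X. h X Y)" "\<And>X Y. h X Y = h Y X"
    "\<And>X Y. X \<in> tangent_space \<A> f p \<Longrightarrow> Y \<in> tangent_space \<A> f p \<Longrightarrow> second_ff \<A> f p X Y = h X Y"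
    "\<And>X Y Z W. X \<in> tangent_space \<A> f p \<Longrightarrow> Y \<in> tangent_space \<A> f p \<Longrightarrow> Z \<in> tangent_space \<A> f p
      \<Longrightarrow> W \<in> tangent_space \<A> f p \<Longrightarrow> curvature \<A> f p X Y Z \<bullet> W = h Y Z \<bullet> h X W - h X Z \<bullet> h Y W"
    "\<And>m E X Y u \<nu>. orthonormal_basis m (tangent_space \<A> f p) E \<Longrightarrow> X \<in> tangent_space \<A> f p
      \<Longrightarrow> Y \<in> tangent_space \<A> f p \<Longrightarrow> u \<in> perp_space \<A> f p
      \<Longrightarrow> curvature_perp \<A> f p X Y u \<bullet> \<nu>
        = (\<Sum>k=1..m. (h Y (E k) \<bullet> u) * (h X (E k) \<bullet> \<nu>) - (h X (E k) \<bullet> u) * (h Y (E k) \<bullet> \<nu>))"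
proof -
  define F where "F = param_at \<A> f p"
  define x where "x = pos_at \<A> p"
  obtain S where S: "immersed_patch S F" and x: "x \<in> S"
    using immersed_patch_param_at[OF assms] unfolding F_def x_def by blast
  interpret immersed_patch S F by (rule S)
  let ?T = "tangent_space \<A> f p"
  have T: "?T = loc_tangent F x" by (simp add: tangent_space_def F_def x_def)
  define h where "h X Y = loc_second_ff F x (tang x X) (tang x Y)" for X Y
  have dird_tang: "dird F x (tang x X) = X" if "X \<in> ?T" for X
    using that by (auto simp: T loc_tangent_def tang_dird[OF x])
  have coords: "coords \<A> f p X = tang x X" if "X \<in> ?T" for X
    using that inv_f_f[OF inj_dird[OF x]]
    by (auto simp: T loc_tangent_def tang_dird[OF x] coords_def simp flip: F_def x_def)
  have lin1: "linear (h X)" for X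
    using linear_compose[OF linear_tang[OF x] linear_loc_second_ff_right[OF x]]
    by (simp add: h_def[abs_def] o_def)
  have sym: "h X Y = h Y X" for X Y
    unfolding h_def by (rule loc_second_ff_sym[OF x])
  have lin2: "linear (\<lambda>X. h X Y)" for Y
    using linear_compose[OF linear_tang[OF x] linear_loc_second_ff_left[OF x]]
    by (simp add: h_def[abs_def] o_def)
  have ff: "second_ff \<A> f p X Y = h X Y" if "X \<in> ?T" "Y \<in> ?T" for X Y
    using that by (simp add: second_ff_def h_def coords flip: F_def x_def)
  have curv: "curvature \<A> f p X Y Z \<bullet> W = h Y Z \<bullet> h X W - h X Z \<bullet> h Y W"
    if "X \<in> ?T" "Y \<in> ?T" "Z \<in> ?T" "W \<in> ?T" for X Y Z W
    using gauss_equation[OF x, of "tang x X" "tang x Y" "tang x Z" "tang x W"] that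
    by (simp add: curvature_def coords dird_tang h_def flip: F_def x_def)
  have curv_perp: "curvature_perp \<A> f p X Y u \<bullet> \<nu>
      = (\<Sum>k=1..m. (h Y (E k) \<bullet> u) * (h X (E k) \<bullet> \<nu>) - (h X (E k) \<bullet> u) * (h Y (E k) \<bullet> \<nu>))"
    if E: "orthonormal_basis m ?T E" and X: "X \<in> ?T" and Y: "Y \<in> ?T"
      and u: "u \<in> perp_space \<A> f p" for m E X Y u \<nu>
  proof -
    have u': "u \<in> orthogonal_comp (loc_tangent F x)" using u by (simp add: perp_space_def T)
    obtain A where A: "\<And>v t. dird F x (A v) \<bullet> dird F x t = loc_second_ff F x v t \<bullet> u"
      "\<And>v w. loc_curvature_perp F v w (\<lambda>y. normal_part (loc_tangent F y) u) x
       = loc_second_ff F x v (A w) - loc_second_ff F x w (A v)"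
      using ricci_equation[OF x u'] by metis
    have ET: "E k \<in> ?T" if "k \<in> {1..m}" for k using orthonormal_basis_mem[OF E that] .
    \<comment> \<open>The shape operator is known through inner products only, so the tangent vector
      \<open>dird F x (A v)\<close> is expanded in \<open>E\<close>; then \<open>tang\<close>, a
      left inverse of the differential, leads back to coordinates.\<close>
    have A_eq: "loc_second_ff F x w (A v) = (\<Sum>k=1..m. (loc_second_ff F x v (tang x (E k)) \<bullet> u)
        *\<^sub>R loc_second_ff F x w (tang x (E k)))" for v w
    proof -
      have "dird F x (A v) = (\<Sum>k=1..m. (dird F x (A v) \<bullet> E k) *\<^sub>R E k)"
        by (rule orthonormal_basis_expansion[OF E]) (simp add: T loc_tangent_def)
      also have "\<dots> = (\<Sum>k=1..m. (loc_second_ff F x v (tang x (E k)) \<bullet> u) *\<^sub>R E k)"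
      proof (rule sum.cong[OF refl])
        fix k assume "k \<in> {1..m}"
        then have "dird F x (A v) \<bullet> E k = loc_second_ff F x v (tang x (E k)) \<bullet> u"
          using A(1)[of v "tang x (E k)"] dird_tang[OF ET] by simp
        then show "(dird F x (A v) \<bullet> E k) *\<^sub>R E k = (loc_second_ff F x v (tang x (E k)) \<bullet> u) *\<^sub>R E k"
          by simp
      qed
      finally have "tang x (dird F x (A v))
          = tang x (\<Sum>k=1..m. (loc_second_ff F x v (tang x (E k)) \<bullet> u) *\<^sub>R E k)" by simp
      then have "A v = (\<Sum>k=1..m. (loc_second_ff F x v (tang x (E k)) \<bullet> u) *\<^sub>R tang x (E k))"
        by (simp add: tang_dird[OF x] linear_sum[OF linear_tang[OF x]] linear_cmul[OF linear_tang[OF x]])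
      then show ?thesis
        by (simp add: linear_sum[OF linear_loc_second_ff_right[OF x]]
            linear_cmul[OF linear_loc_second_ff_right[OF x]])
    qed
    have "curvature_perp \<A> f p X Y u
        = loc_second_ff F x (tang x X) (A (tang x Y)) - loc_second_ff F x (tang x Y) (A (tang x X))"
      using X Y by (simp add: curvature_perp_def coords A(2) flip: F_def x_def)
    then show ?thesis
      by (simp add: A_eq inner_diff_left inner_sum_left sum_subtractf h_def)
  qed
  show thesis
    by (rule that[of h]) (fact lin1 lin2 sym ff curv curv_perp)+
qed

section \<open>The complex structure as a linear isometry\<close>

lemma linear_cplx_J: "linear cplx_J"
  by (rule linearI) (simp_all add: cplx_J_def vec_eq_iff algebra_simps)

lemma cplx_J_inner: "cplx_J v \<bullet> cplx_J w = v \<bullet> w"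
  by (simp add: cplx_J_def inner_vec_def inner_complex_def add.commute)

lemma orthonormal_basis_cplx_J:
  assumes "orthonormal_basis m V E"
  shows "orthonormal_basis m (cplx_J ` V) (\<lambda>i. cplx_J (E i))"
  using assms linear_span_image[OF linear_cplx_J, of "E ` {1..m}"]
  by (simp add: orthonormal_basis_def cplx_J_inner image_image)

section \<open>\<open>H\<close>-umbilical frames\<close>

text \<open>The linear algebra at one point, free of charts. \<open>V\<close> and \<open>W\<close>
  are to be the tangent and the normal space, and \<open>J\<close> is present only through
  \<open>N i\<close>, which will be \<open>cplx_J (E i)\<close>.\<close>

locale H_umbilical_frame =
  fixes n :: nat and V W :: "'b::euclidean_space set" and E N :: "nat \<Rightarrow> 'b"
    and h :: "'b \<Rightarrow> 'b \<Rightarrow> 'b" and lam mu :: real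
  assumes n: "n \<ge> 2"
    and E: "orthonormal_basis n V E" and N: "orthonormal_basis n W N"
    and linear_right: "linear (h X)" and linear_left: "linear (\<lambda>X. h X Y)"
    and h_sym: "h X Y = h Y X"
    and h_1_1: "h (E 1) (E 1) = lam *\<^sub>R N 1"
    and h_j_j: "j \<in> {2..n} \<Longrightarrow> h (E j) (E j) = mu *\<^sub>R N 1"
    and h_1_j: "j \<in> {2..n} \<Longrightarrow> h (E 1) (E j) = mu *\<^sub>R N j"
    and h_j_k: "j \<in> {2..n} \<Longrightarrow> k \<in> {2..n} \<Longrightarrow> j \<noteq> k \<Longrightarrow> h (E j) (E k) = 0"
begin

lemma h_diagonal: "i \<in> {1..n} \<Longrightarrow> h (E i) (E i) = (if i = 1 then lam else mu) *\<^sub>R N 1"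
  using h_1_1 h_j_j[of i] by auto

lemma h_off_diagonal:
  "i \<in> {1..n} \<Longrightarrow> k \<in> {1..n} \<Longrightarrow> i \<noteq> k \<Longrightarrow>
    h (E i) (E k) = (if i = 1 then mu *\<^sub>R N k else if k = 1 then mu *\<^sub>R N i else 0)"
  using h_1_j[of k] h_1_j[of i] h_j_k[of i k] h_sym[of "E i" "E 1"] by auto

lemma sum_first: "(\<Sum>i=1..n. if i = 1 then a else b) = a + (real n - 1) * (b::real)"
  using n sum.atLeast_Suc_atMost[of 1 n "\<lambda>i. if i = 1 then a else b"] by (simp add: of_nat_diff)

lemma trace_h:
  assumes "orthonormal_basis n V e"
  shows "(\<Sum>i=1..n. h (e i) (e i)) = (lam + (real n - 1) * mu) *\<^sub>R N 1"
proof -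
  have "(\<Sum>i=1..n. h (e i) (e i)) = (\<Sum>i=1..n. h (E i) (E i))"
    by (rule trace_orthonormal_basis[OF assms E linear_right linear_left])
  also have "\<dots> = (\<Sum>i=1..n. (if i = 1 then lam else mu) *\<^sub>R N 1)"
    by (intro sum.cong refl h_diagonal)
  finally show ?thesis by (simp only: sum_first flip: scaleR_sum_left)
qed

lemma N_1_N_1: "N 1 \<bullet> N 1 = 1"
  using orthonormal_basis_inner[OF N, of 1 1] n by simp

text \<open>In the frame, the diagonal contributes
  \<open>lam\<^sup>2 + (n - 1) * mu\<^sup>2\<close>, the first row and column
  \<open>2 * (n - 1) * mu\<^sup>2\<close>.\<close>

lemma sum_norm2_h:
  assumes e: "orthonormal_basis n V e"
  shows "(\<Sum>i=1..n. \<Sum>j=1..n. h (e i) (e j) \<bullet> h (e i) (e j)) = lam\<^sup>2 + 3 * (real n - 1) * mu\<^sup>2"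
proof -
  have "(\<Sum>i=1..n. \<Sum>j=1..n. h (e i) (e j) \<bullet> h (e i) (e j))
      = (\<Sum>i=1..n. \<Sum>j=1..n. h (E i) (E j) \<bullet> h (E i) (E j))"
    using sum_norm2_two_orthonormal_bases[OF e E e E, of "\<lambda>_. h" "{()}"] linear_right linear_left
    by simp
  also have "\<dots> = (\<Sum>i=1..n. \<Sum>j=1..n. (if i = j then (if i = 1 then lam\<^sup>2 else mu\<^sup>2) else 0)
      + (if i = j then 0 else if i = 1 \<or> j = 1 then mu\<^sup>2 else 0))"
  proof (intro sum.cong refl)
    fix i j assume ij: "i \<in> {1..n}" "j \<in> {1..n}"
    show "h (E i) (E j) \<bullet> h (E i) (E j) = (if i = j then (if i = 1 then lam\<^sup>2 else mu\<^sup>2) else 0)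
      + (if i = j then 0 else if i = 1 \<or> j = 1 then mu\<^sup>2 else 0)"
      using ij N_1_N_1 orthonormal_basis_inner[OF N ij(1,1)] orthonormal_basis_inner[OF N ij(2,2)]
      by (cases "i = j") (simp_all add: h_diagonal h_off_diagonal power2_eq_square del: One_nat_def)
  qed
  also have "\<dots> = lam\<^sup>2 + (real n - 1) * mu\<^sup>2 + 2 * (real n - 1) * mu\<^sup>2"
    using n sum_off_diagonal[of n "mu\<^sup>2" 0]
    by (simp add: sum.distrib sum_first[unfolded One_nat_def])
  finally show ?thesis by (simp add: algebra_simps)
qed

text \<open>The full double sum is the squared norm of the trace of \<open>h\<close> minus the
  squared norm of \<open>h\<close>, and its diagonal vanishes. The coefficient \<open>n - 4\<close>
  arises as \<open>(n - 1) - 3\<close>.\<close>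

lemma sum_sectional_curvatures:
  assumes e: "orthonormal_basis n V e"
  shows "(\<Sum>i=1..n. \<Sum>j\<in>{i<..n}. h (e j) (e j) \<bullet> h (e i) (e i) - h (e i) (e j) \<bullet> h (e j) (e i))
    = (real n - 1) * (2 * lam * mu + (real n - 4) * mu\<^sup>2) / 2"
proof -
  define g where "g i j = h (e j) (e j) \<bullet> h (e i) (e i) - h (e i) (e j) \<bullet> h (e j) (e i)" for i j
  have "(\<Sum>i=1..n. \<Sum>j=1..n. g i j)
      = (\<Sum>i=1..n. h (e i) (e i)) \<bullet> (\<Sum>i=1..n. h (e i) (e i))
        - (\<Sum>i=1..n. \<Sum>j=1..n. h (e i) (e j) \<bullet> h (e i) (e j))"
    unfolding g_def h_sym[of "e j" "e i" for i j] inner_sum_left inner_sum_right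
    by (simp add: sum_subtractf inner_commute)
  also have "\<dots> = (lam + (real n - 1) * mu)\<^sup>2 - (lam\<^sup>2 + 3 * (real n - 1) * mu\<^sup>2)"
    unfolding trace_h[OF e] sum_norm2_h[OF e]
    by (simp add: N_1_N_1 power2_eq_square del: One_nat_def)
  finally have "(\<Sum>i=1..n. \<Sum>j=1..n. g i j)
      = (lam + (real n - 1) * mu)\<^sup>2 - (lam\<^sup>2 + 3 * (real n - 1) * mu\<^sup>2)" .
  moreover have "(\<Sum>i=1..n. \<Sum>j=1..n. g i j) = (\<Sum>i=1..n. g i i) + 2 * (\<Sum>i=1..n. \<Sum>j\<in>{i<..n}. g i j)"
    by (rule sum_square_eq_diagonal_plus_triangle) (simp add: g_def inner_commute)
  moreover have "g i i = 0" for i by (simp add: g_def)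
  ultimately show ?thesis unfolding g_def by (simp add: power2_eq_square algebra_simps)
qed

lemma norm2_trace_h:
  "orthonormal_basis n V e \<Longrightarrow> (norm (\<Sum>i=1..n. h (e i) (e i)))\<^sup>2 = (lam + (real n - 1) * mu)\<^sup>2"
  unfolding trace_h power2_norm_eq_inner
  by (simp add: N_1_N_1 power2_eq_square del: One_nat_def)

text \<open>The right-hand side of the Ricci equation, i.e. the commutator of two shape operators.\<close>

definition Q :: "'b \<Rightarrow> 'b \<Rightarrow> 'b \<Rightarrow> 'b \<Rightarrow> real"
  where "Q X Y u v = (\<Sum>k=1..n. (h Y (E k) \<bullet> u) * (h X (E k) \<bullet> v) - (h X (E k) \<bullet> u) * (h Y (E k) \<bullet> v))"

lemma linear_Q:
  "linear (\<lambda>X. Q X Y u v)" "linear (\<lambda>Y. Q X Y u v)" "linear (\<lambda>u. Q X Y u v)" "linear (\<lambda>v. Q X Y u v)"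
  unfolding Q_def
  by (auto intro!: linear_compose_sum linearI
      simp: linear_add[OF linear_left] linear_cmul[OF linear_left]
        inner_add_left inner_add_right algebra_simps)

text \<open>For given \<open>i\<close> and \<open>a\<close> at most one \<open>k\<close> yields a
  nonzero component. Naming this \<open>k\<close> explicitly lets the sums over \<open>k\<close> in
  \<open>Q\<close> collapse to single terms. If neither \<open>i\<close> nor \<open>a\<close> is 1,
  the candidate is \<open>k = 1\<close>, and its entry is zero unless \<open>i = a\<close>.\<close>

lemma h_component:
  assumes "i \<in> {1..n}" "k \<in> {1..n}" "a \<in> {1..n}"
  shows "h (E i) (E k) \<bullet> N a =
    (if k = (if i = 1 then a else if a = 1 then i else 1)
     then (if i = 1 \<and> a = 1 then lam else if i = 1 \<or> a = 1 \<or> i = a then mu else 0) else 0)"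
proof (cases "i = k")
  case True
  then show ?thesis using assms n orthonormal_basis_inner[OF N _ assms(3), of 1]
    by (auto simp: h_diagonal simp del: One_nat_def)
next
  case False
  then show ?thesis
    using assms orthonormal_basis_inner[OF N assms(1,3)] orthonormal_basis_inner[OF N assms(2,3)]
    by (auto simp: h_off_diagonal simp del: One_nat_def)
qed

text \<open>For \<open>i \<noteq> j\<close> the first factor is the sectional curvature of the plane
  of \<open>E i\<close> and \<open>E j\<close>: through \<open>J\<close>, the normal curvature
  mirrors the curvature of the tangent bundle.\<close>

lemma Q_frame:
  assumes ij: "i \<in> {1..n}" "j \<in> {1..n}" and ab: "a \<in> {1..n}" "b \<in> {1..n}"
  shows "Q (E i) (E j) (N a) (N b) = (if i = j then 0 else if i = 1 \<or> j = 1 then mu * (lam - mu) else mu\<^sup>2)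
     * ((if i = b \<and> j = a then 1 else 0) - (if i = a \<and> j = b then 1 else 0))"
proof -
  define r where "r i a = (if i = 1 then a else if a = 1 then i else 1)" for i a :: nat
  define s where "s i a = (if i = 1 \<and> a = 1 then lam else if i = 1 \<or> a = 1 \<or> i = a then mu else 0)" for i a :: nat
  have r: "r i a \<in> {1..n}" if "i \<in> {1..n}" "a \<in> {1..n}" for i a
    using that by (auto simp: r_def)
  have delta: "(\<Sum>k=1..n. (h (E j) (E k) \<bullet> N a) * (h (E i) (E k) \<bullet> N b))
      = (if r j a = r i b then s j a * s i b else 0)"
    if "i \<in> {1..n}" "j \<in> {1..n}" "a \<in> {1..n}" "b \<in> {1..n}" for i j a b
  proof -
    have "(\<Sum>k=1..n. (h (E j) (E k) \<bullet> N a) * (h (E i) (E k) \<bullet> N b))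
       = (\<Sum>k=1..n. if k = r j a then (if r j a = r i b then s j a * s i b else 0) else 0)"
      by (intro sum.cong refl, subst (1 2) h_component) (use that in \<open>simp_all add: r_def s_def\<close>)
    then show ?thesis using r[OF that(2,3)] by simp
  qed
  have "Q (E i) (E j) (N a) (N b)
      = (if r j a = r i b then s j a * s i b else 0) - (if r i a = r j b then s i a * s j b else 0)"
    using delta[OF ij ab] delta[OF ij(2,1) ab] by (simp add: Q_def sum_subtractf)
  also have "\<dots> = (if i = j then 0 else if i = 1 \<or> j = 1 then mu * (lam - mu) else mu\<^sup>2)
     * ((if i = b \<and> j = a then 1 else 0) - (if i = a \<and> j = b then 1 else 0))"
    unfolding r_def s_def
    by (cases "i = 1"; cases "j = 1"; cases "a = 1"; cases "b = 1"; cases "i = j"; cases "a = b")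
       (auto simp: power2_eq_square algebra_simps simp del: One_nat_def)
  finally show ?thesis .
qed

text \<open>The square of \<open>Q\<close> is symmetric in both pairs of arguments and vanishes on
  the diagonals, so the sum over \<open>i < j\<close> and \<open>a < b\<close> is a quarter of the
  full sum, which may be computed in the frame. There each \<open>i \<noteq> j\<close> contributes
  twice, from \<open>(a, b) = (i, j)\<close> and from \<open>(a, b) = (j, i)\<close>.\<close>

lemma sum_Q2:
  assumes e: "orthonormal_basis n V e" and u: "orthonormal_basis n W u"
  shows "(\<Sum>i=1..n. \<Sum>j\<in>{i<..n}. \<Sum>a=1..n. \<Sum>b\<in>{a<..n}. (Q (e i) (e j) (u a) (u b))\<^sup>2)
    = (real n - 1) * (mu * (lam - mu))\<^sup>2 + (real n - 1) * (real n - 2) / 2 * (mu\<^sup>2)\<^sup>2"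
proof -
  have antisym: "(Q X Y v w)\<^sup>2 = (Q Y X v w)\<^sup>2" "(Q X Y v w)\<^sup>2 = (Q X Y w v)\<^sup>2" for X Y v w
    by (simp_all add: Q_def sum_subtractf power2_commute mult.commute)
  have zero: "Q X X v w = 0" "Q X Y v v = 0" for X Y v w
    by (simp_all add: Q_def mult.commute)
  define g where "g i j = (\<Sum>a=1..n. \<Sum>b\<in>{a<..n}. (Q (e i) (e j) (u a) (u b))\<^sup>2)" for i j
  have g: "(\<Sum>a=1..n. \<Sum>b=1..n. (Q (e i) (e j) (u a) (u b))\<^sup>2) = 2 * g i j" for i j
    unfolding g_def
    by (subst sum_square_eq_diagonal_plus_triangle) (simp_all add: zero antisym(2))
  have "(\<Sum>i=1..n. \<Sum>j=1..n. g i j) = 2 * (\<Sum>i=1..n. \<Sum>j\<in>{i<..n}. g i j)"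
  proof (subst sum_square_eq_diagonal_plus_triangle)
    show "g i j = g j i" for i j unfolding g_def by (intro sum.cong refl antisym(1))
    show "(\<Sum>i=1..n. g i i) + 2 * (\<Sum>i=1..n. \<Sum>j\<in>{i<..n}. g i j)
      = 2 * (\<Sum>i=1..n. \<Sum>j\<in>{i<..n}. g i j)" by (simp add: g_def zero)
  qed
  then have "4 * (\<Sum>i=1..n. \<Sum>j\<in>{i<..n}. g i j)
      = (\<Sum>i=1..n. \<Sum>j=1..n. \<Sum>a=1..n. \<Sum>b=1..n. (Q (e i) (e j) (u a) (u b))\<^sup>2)"
    unfolding g by (simp flip: sum_distrib_left)
  also have "\<dots> = (\<Sum>i=1..n. \<Sum>j=1..n. \<Sum>a=1..n. \<Sum>b=1..n. (Q (E i) (E j) (N a) (N b))\<^sup>2)"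
    using sum_norm2_four_orthonormal_bases[OF e E u N, of Q] linear_Q
    by (simp add: power2_eq_square)
  also have "\<dots> = (\<Sum>i=1..n. \<Sum>j=1..n. 2 *
      (if i = j then 0 else if i = 1 \<or> j = 1 then (mu * (lam - mu))\<^sup>2 else (mu\<^sup>2)\<^sup>2))"
  proof (intro sum.cong refl)
    fix i j assume ij: "i \<in> {1..n}" "j \<in> {1..n}"
    define K where "K = (if i = j then 0 else if i = 1 \<or> j = 1 then mu * (lam - mu) else mu\<^sup>2)"
    \<comment> \<open>For \<open>i = j\<close> the two summands on the right overlap, harmlessly
      since then \<open>K = 0\<close>.\<close>
    have "(\<Sum>a=1..n. \<Sum>b=1..n. (Q (E i) (E j) (N a) (N b))\<^sup>2)
       = (\<Sum>a=1..n. \<Sum>b=1..n. (if a = j then (if b = i then K\<^sup>2 else 0) else 0)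
          + (if a = i then (if b = j then K\<^sup>2 else 0) else 0))"
      by (intro sum.cong refl) (use ij in \<open>auto simp: Q_frame K_def\<close>)
    also have "\<dots> = 2 * K\<^sup>2"
    proof -
      have "(\<Sum>a=1..n. \<Sum>b=1..n. if a = k then (if b = l then K\<^sup>2 else 0) else 0) = K\<^sup>2"
        if "k \<in> {1..n}" "l \<in> {1..n}" for k l
      proof -
        have "(\<Sum>b=1..n. if a = k then (if b = l then K\<^sup>2 else 0) else 0) = (if a = k then K\<^sup>2 else 0)" for a
          using that by simp
        then show ?thesis using that by simp
      qed
      then show ?thesis using ij by (simp only: sum.distrib)
    qed
    finally show "(\<Sum>a=1..n. \<Sum>b=1..n. (Q (E i) (E j) (N a) (N b))\<^sup>2)
      = 2 * (if i = j then 0 else if i = 1 \<or> j = 1 then (mu * (lam - mu))\<^sup>2 else (mu\<^sup>2)\<^sup>2)"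
      by (simp add: K_def split: if_splits)
  qed
  also have "\<dots> = 2 * (2 * (real n - 1) * (mu * (lam - mu))\<^sup>2 + (real n - 1) * (real n - 2) * (mu\<^sup>2)\<^sup>2)"
    using sum_off_diagonal[of n "(mu * (lam - mu))\<^sup>2" "(mu\<^sup>2)\<^sup>2"] n
    by (simp only: sum_distrib_left[symmetric])
  finally show ?thesis unfolding g_def by (simp add: field_simps)
qed

text \<open>The values of \<open>h\<close> on \<open>E 1\<close> and on \<open>E 2\<close> already
  detect \<open>lam\<close> and \<open>mu\<close>; the second vector exists because
  \<open>n \<ge> 2\<close>.\<close>

lemma h_vanishes_iff: "(\<forall>X\<in>V. \<forall>Y\<in>V. h X Y = 0) \<longleftrightarrow> lam = 0 \<and> mu = 0"
proof
  assume z: "\<forall>X\<in>V. \<forall>Y\<in>V. h X Y = 0"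
  have V: "E 1 \<in> V" "E 2 \<in> V" using orthonormal_basis_mem[OF E] n by auto
  have "N 1 \<noteq> 0" using N_1_N_1 by auto
  then show "lam = 0 \<and> mu = 0"
    using z V h_1_1 h_j_j[of 2] n by auto
next
  assume z: "lam = 0 \<and> mu = 0"
  have E0: "h (E i) (E k) = 0" if "i \<in> {1..n}" "k \<in> {1..n}" for i k
    using h_diagonal[OF that(1)] h_off_diagonal[OF that] z by (cases "i = k") auto
  show "\<forall>X\<in>V. \<forall>Y\<in>V. h X Y = 0"
  proof (intro ballI)
    fix X Y assume XY: "X \<in> V" "Y \<in> V"
    have "h (E i) Y = 0" if "i \<in> {1..n}" for i
      by (subst orthonormal_basis_expansion[OF E XY(2)])
         (use that in \<open>simp add: linear_sum[OF linear_right] linear_cmul[OF linear_right] E0\<close>)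
    then show "h X Y = 0"
      by (subst orthonormal_basis_expansion[OF E XY(1)])
         (simp add: linear_sum[OF linear_left] linear_cmul[OF linear_left])
  qed
qed

end

text \<open>By the Gauss and Ricci equations everything depends on the second fundamental form at
  \<open>p\<close>, so the local frame is evaluated there; the Lagrangian condition makes its image
  under \<open>J\<close> an orthonormal basis of the normal space.\<close>

lemma H_umbilical_point:
  fixes \<A> :: "('m, 'n::finite) chart set" and f :: "'m \<Rightarrow> complex^'n"
  assumes n: "CARD('n) \<ge> 2" and M: "smooth_manifold M \<A>" and f: "immersion M \<A> f"
    and lagr: "lagrangian M \<A> f" and umb: "H_umbilical M \<A> f" and p: "p \<in> topspace M"
    and e: "orthonormal_basis CARD('n) (tangent_space \<A> f p) e"
    and u: "orthonormal_basis CARD('n) (perp_space \<A> f p) u"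
  obtains lam mu :: real where
    "norm_scalar_curv \<A> f p e
      = (2 * lam * mu + (real CARD('n) - 4) * mu\<^sup>2) / real CARD('n)"
    "(norm (mean_curvature \<A> f p e))\<^sup>2 = ((lam + (real CARD('n) - 1) * mu) / real CARD('n))\<^sup>2"
    "norm_normal_scalar_curv \<A> f p e u = 2 / (real CARD('n) * (real CARD('n) - 1)) *
      sqrt ((real CARD('n) - 1) * (mu * (lam - mu))\<^sup>2
        + (real CARD('n) - 1) * (real CARD('n) - 2) / 2 * (mu\<^sup>2)\<^sup>2)"
    "(\<forall>X\<in>tangent_space \<A> f p. \<forall>Y\<in>tangent_space \<A> f p. second_ff \<A> f p X Y = 0)
      \<longleftrightarrow> lam = 0 \<and> mu = 0"
proof (rule second_ff_extension[OF M f p])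
  let ?n = "CARD('n)" and ?T = "tangent_space \<A> f p" and ?P = "perp_space \<A> f p"
  fix h assume h: "\<And>X. linear (h X)" "\<And>Y. linear (\<lambda>X. h X Y)" "\<And>X Y. h X Y = h Y X"
    "\<And>X Y. X \<in> ?T \<Longrightarrow> Y \<in> ?T \<Longrightarrow> second_ff \<A> f p X Y = h X Y"
    "\<And>X Y Z W. X \<in> ?T \<Longrightarrow> Y \<in> ?T \<Longrightarrow> Z \<in> ?T \<Longrightarrow> W \<in> ?T
      \<Longrightarrow> curvature \<A> f p X Y Z \<bullet> W = h Y Z \<bullet> h X W - h X Z \<bullet> h Y W"
    "\<And>m E X Y u \<nu>. orthonormal_basis m ?T E \<Longrightarrow> X \<in> ?T
      \<Longrightarrow> Y \<in> ?T \<Longrightarrow> u \<in> ?P \<Longrightarrow> curvature_perp \<A> f p X Y u \<bullet> \<nu>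
        = (\<Sum>k=1..m. (h Y (E k) \<bullet> u) * (h X (E k) \<bullet> \<nu>) - (h X (E k) \<bullet> u) * (h Y (E k) \<bullet> \<nu>))"
  obtain E' :: "nat \<Rightarrow> 'm \<Rightarrow> complex^'n" and lam' mu' where
    E': "orthonormal_basis ?n ?T (\<lambda>i. E' i p)"
    "second_ff \<A> f p (E' 1 p) (E' 1 p) = (lam' p :: real) *\<^sub>R cplx_J (E' 1 p)"
    "\<forall>j\<in>{2..?n}. second_ff \<A> f p (E' j p) (E' j p) = (mu' p :: real) *\<^sub>R cplx_J (E' 1 p)"
    "\<forall>j\<in>{2..?n}. second_ff \<A> f p (E' 1 p) (E' j p) = mu' p *\<^sub>R cplx_J (E' j p)"
    "\<forall>j\<in>{2..?n}. \<forall>k\<in>{2..?n}. j \<noteq> k \<longrightarrow> second_ff \<A> f p (E' j p) (E' k p) = 0"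
    using umb p unfolding H_umbilical_def by metis
  define E lam mu where "E i = E' i p" and "lam = lam' p" and "mu = mu' p" for i
  have E: "orthonormal_basis ?n ?T E" using E'(1) by (simp add: E_def[abs_def])
  have ET: "E i \<in> ?T" if "i \<in> {1..?n}" for i using orthonormal_basis_mem[OF E that] .
  have P: "cplx_J ` ?T = ?P"
    using lagr p by (simp add: lagrangian_def bij_betw_def)
  interpret H_umbilical_frame ?n ?T ?P E "\<lambda>i. cplx_J (E i)" h lam mu
  proof (rule H_umbilical_frame.intro)
    show "orthonormal_basis ?n ?P (\<lambda>i. cplx_J (E i))"
      using orthonormal_basis_cplx_J[OF E] P by simp
    show "h (E 1) (E 1) = lam *\<^sub>R cplx_J (E 1)"
      using E'(2) h(4)[OF ET ET, of 1 1] n by (simp add: E_def lam_def)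
    fix j assume j: "j \<in> {2..?n}"
    show "h (E j) (E j) = mu *\<^sub>R cplx_J (E 1)"
      using E'(3) h(4)[OF ET ET, of j j] j by (simp add: E_def mu_def)
    show "h (E 1) (E j) = mu *\<^sub>R cplx_J (E j)"
      using E'(4) h(4)[OF ET ET, of 1 j] j by (simp add: E_def mu_def)
    fix k assume "k \<in> {2..?n}" "j \<noteq> k"
    then show "h (E j) (E k) = 0"
      using E'(5) h(4)[OF ET ET, of j k] j by (simp add: E_def)
  qed (fact n E h(1-3))+
  have eT: "e i \<in> ?T" if "i \<in> {1..?n}" for i using orthonormal_basis_mem[OF e that] .
  have uP: "u i \<in> ?P" if "i \<in> {1..?n}" for i using orthonormal_basis_mem[OF u that] .
  have "(\<Sum>i=1..?n. \<Sum>j\<in>{i<..?n}. curvature \<A> f p (e i) (e j) (e j) \<bullet> e i)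
      = (\<Sum>i=1..?n. \<Sum>j\<in>{i<..?n}. h (e j) (e j) \<bullet> h (e i) (e i) - h (e i) (e j) \<bullet> h (e j) (e i))"
    by (intro sum.cong refl h(5)) (auto intro: eT)
  then have A: "norm_scalar_curv \<A> f p e
      = (2 * lam * mu + (real CARD('n) - 4) * mu\<^sup>2) / real CARD('n)"
    using n unfolding norm_scalar_curv_def by (simp only: sum_sectional_curvatures[OF e]) (simp add: field_simps)
  have "(\<Sum>i=1..?n. second_ff \<A> f p (e i) (e i)) = (\<Sum>i=1..?n. h (e i) (e i))"
    by (intro sum.cong refl h(4)) (auto intro: eT)
  then have B: "(norm (mean_curvature \<A> f p e))\<^sup>2 = ((lam + (real CARD('n) - 1) * mu) / real CARD('n))\<^sup>2"
    unfolding mean_curvature_def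
    by (simp only: norm_scaleR power_mult_distrib norm2_trace_h[OF e]) (simp add: power_divide)
  have "curvature_perp \<A> f p (e i) (e j) (u a) \<bullet> u b = Q (e i) (e j) (u a) (u b)"
    if "i \<in> {1..?n}" "j \<in> {i<..?n}" "a \<in> {1..?n}" "b \<in> {a<..?n}" for i j a b
    unfolding Q_def by (rule h(6)[OF E]) (use that in \<open>auto intro: eT uP\<close>)
  then have "(\<Sum>i=1..?n. \<Sum>j\<in>{i<..?n}. \<Sum>a=1..?n. \<Sum>b\<in>{a<..?n}.
        (curvature_perp \<A> f p (e i) (e j) (u a) \<bullet> u b)\<^sup>2)
      = (\<Sum>i=1..?n. \<Sum>j\<in>{i<..?n}. \<Sum>a=1..?n. \<Sum>b\<in>{a<..?n}. (Q (e i) (e j) (u a) (u b))\<^sup>2)"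
    by (intro sum.cong refl) simp
  then have C: "norm_normal_scalar_curv \<A> f p e u = 2 / (real CARD('n) * (real CARD('n) - 1)) *
      sqrt ((real CARD('n) - 1) * (mu * (lam - mu))\<^sup>2
        + (real CARD('n) - 1) * (real CARD('n) - 2) / 2 * (mu\<^sup>2)\<^sup>2)"
    unfolding norm_normal_scalar_curv_def by (simp only: sum_Q2[OF e u])
  have D: "(\<forall>X\<in>?T. \<forall>Y\<in>?T. second_ff \<A> f p X Y = 0) \<longleftrightarrow> lam = 0 \<and> mu = 0"
    using h_vanishes_iff h(4) by simp
  show thesis using that[OF A B C D] .
qed

text \<open>The bases \<open>e p\<close> and \<open>u p\<close> are arbitrary at every point. The
  equivalence is stated from dimension three on: in dimension two the remainder with the factor
  \<open>n - 2\<close> vanishes identically, and equality also holds at points where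
  \<open>lam = 3 * mu\<close> or \<open>lam = - mu\<close>.\<close>

theorem theorem4p1:
  fixes M :: "'m topology"
    and \<A> :: "('m, 'n::finite) chart set"
    and f :: "'m \<Rightarrow> complex^'n"
    and e u :: "'m \<Rightarrow> nat \<Rightarrow> complex^'n"
  assumes "CARD('n) \<ge> 2"
    and "smooth_manifold M \<A>"
    and "immersion M \<A> f"
    and "lagrangian M \<A> f"
    and "H_umbilical M \<A> f"
    and "\<And>p. p \<in> topspace M \<Longrightarrow> orthonormal_basis CARD('n) (tangent_space \<A> f p) (e p)"
    and "\<And>p. p \<in> topspace M \<Longrightarrow> orthonormal_basis CARD('n) (perp_space \<A> f p) (u p)"
  shows "(\<forall>p\<in>topspace M. norm_scalar_curv \<A> f p (e p)
            \<le> (norm (mean_curvature \<A> f p (e p)))\<^sup>2 - norm_normal_scalar_curv \<A> f p (e p) (u p))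
    \<and> (totally_geodesic M \<A> f \<longrightarrow>
         (\<forall>p\<in>topspace M. norm_scalar_curv \<A> f p (e p)
            = (norm (mean_curvature \<A> f p (e p)))\<^sup>2 - norm_normal_scalar_curv \<A> f p (e p) (u p)))
    \<and> (CARD('n) \<ge> 3 \<longrightarrow>
         ((\<forall>p\<in>topspace M. norm_scalar_curv \<A> f p (e p)
            = (norm (mean_curvature \<A> f p (e p)))\<^sup>2 - norm_normal_scalar_curv \<A> f p (e p) (u p))
          \<longleftrightarrow> totally_geodesic M \<A> f))"
proof -
  let ?\<rho> = "\<lambda>p. norm_scalar_curv \<A> f p (e p)"
  let ?rhs = "\<lambda>p. (norm (mean_curvature \<A> f p (e p)))\<^sup>2 - norm_normal_scalar_curv \<A> f p (e p) (u p)"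
  let ?geo = "\<lambda>p. \<forall>X\<in>tangent_space \<A> f p. \<forall>Y\<in>tangent_space \<A> f p. second_ff \<A> f p X Y = 0"
  have "?\<rho> p \<le> ?rhs p \<and> (?geo p \<longrightarrow> ?\<rho> p = ?rhs p) \<and> (CARD('n) \<ge> 3 \<longrightarrow> ?\<rho> p = ?rhs p \<longrightarrow> ?geo p)"
    if p: "p \<in> topspace M" for p
  proof -
    obtain lam mu where
      *: "?\<rho> p = (2 * lam * mu + (real CARD('n) - 4) * mu\<^sup>2) / real CARD('n)"
      "(norm (mean_curvature \<A> f p (e p)))\<^sup>2 = ((lam + (real CARD('n) - 1) * mu) / real CARD('n))\<^sup>2"
      "norm_normal_scalar_curv \<A> f p (e p) (u p) = 2 / (real CARD('n) * (real CARD('n) - 1)) *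
        sqrt ((real CARD('n) - 1) * (mu * (lam - mu))\<^sup>2
          + (real CARD('n) - 1) * (real CARD('n) - 2) / 2 * (mu\<^sup>2)\<^sup>2)"
      "?geo p \<longleftrightarrow> lam = 0 \<and> mu = 0"
      using H_umbilical_point[OF assms(1-5) p assms(6,7)[OF p]] by blast
    have N: "real CARD('n) \<ge> 2" using assms(1) by linarith
    have le: "?\<rho> p \<le> ?rhs p"
      unfolding *(1-3) by (rule umbilical_scalar_inequality(1)[OF N])
    have eq: "?geo p" if "CARD('n) \<ge> 3" "?\<rho> p = ?rhs p"
    proof -
      have "real CARD('n) \<ge> 3" using that(1) by linarith
      from umbilical_scalar_inequality(2)[OF N this that(2)[unfolded *(1-3)]] *(4)
      show ?thesis by blast
    qed
    have "?\<rho> p = ?rhs p" if "?geo p"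
      unfolding *(1-3) using that *(4) by simp
    with le eq show ?thesis by blast
  qed
  then show ?thesis unfolding totally_geodesic_def by blast
qed

end
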